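(* Let $n>1$ be an odd integer and let $r\geqslant 1$. Then, modulo $[n^r]\prod_{j=1}^r\Phi_{n^j}(q)^2$, \begin{align*} \sum_{k=0}^{(n^r-1)/2}[4k+1]\frac{(q;q^2)_k^4} {(q^2;q^2)_k^4} &\equiv q^{(1-n)/2} [n] \sum_{k=0}^{(n^{r-1}-1)/2}[4k+1]_{q^n}\frac{(q^{n};q^{2n})_k^4} {(q^{2n};q^{2n})_k^4},\\ \sum_{k=0}^{n^r-1}[4k+1]\frac{(q;q^2)_k^4} {(q^2;q^2)_k^4} &\equiv q^{(1-n)/2} [n] \sum_{k=0}^{n^{r-1}-1}[4k+1]_{q^n}\frac{(q^{n};q^{2n})_k^4} {(q^{2n};q^{2n})_k^4}. \end{align*}
   Context: Notation: $(a;q)_k=(1-a)(1-aq)\cdots(1-aq^{k-1})$ (with $(a;q)_0=1$) is the $q$-shifted factorial; $[m]=[m]_q=1+q+\cdots+q^{m-1}$ is the $q$-integer, and $[m]_{q^n}=1+q^n+\cdots+q^{n(m-1)}$. $\Phi_m(q)$ denotes the $m$-th cyclotomic polynomial in $q$. For rational functions $A(q),B(q)$ and a polynomial $P(q)$, $A\equiv B\pmod{P}$ means that $A-B$ can be written as a quotient of polynomials whose numerator is divisible by $P(q)$ and whose denominator is relatively prime to $P(q)$. *)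

theory Defs
  imports Complex_Main "HOL-Computational_Algebra.Computational_Algebra"
begin

type_synonym rfun = "complex poly fract"

definition qvar :: rfun where
  "qvar = Fract [:0, 1:] 1"

definition qpoch :: "rfun \<Rightarrow> rfun \<Rightarrow> nat \<Rightarrow> rfun" where
  "qpoch a p k = (\<Prod>i<k. 1 - a * p ^ i)"

definition qint :: "rfun \<Rightarrow> nat \<Rightarrow> rfun" where
  "qint p m = (\<Sum>i<m. p ^ i)"

definition qint_poly :: "nat \<Rightarrow> complex poly" where
  "qint_poly m = (\<Sum>i<m. monom 1 i)"

definition cyclotomic :: "nat \<Rightarrow> complex poly" where
  "cyclotomic m = (\<Prod>k\<in>{k\<in>{1..m}. coprime k m}. [:- cis (2 * pi * real k / real m), 1:])"

definition qcong :: "rfun \<Rightarrow> rfun \<Rightarrow> complex poly \<Rightarrow> bool" where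
  "qcong A B P \<longleftrightarrow> (\<exists>u v. v \<noteq> 0 \<and> A - B = Fract u v \<and> P dvd u \<and> coprime v P)"

end

(*
Replace the factors (1 - q^e)^2 by (1 - a q^e)(1 - q^e / a) = 1 + q^(2 e) - q^e x with
x = a + 1/a; the theorem is the case x = 2. Clearing denominators, the difference of the two sides
becomes a polynomial F in x over C(q).

For a = q^M with M = n (2 l + 1) both sums terminate and have a closed form, and the two closed
forms agree. So F vanishes at the K' + 1 points x_M = q^M + q^(-M), where K' is the upper limit of
the sum on the right.

At a root of unity z of odd order d > 1 dividing n^r the terms of each sum are periodic up to
constants and cancel in pairs k <-> (d - 1)/2 - k, so all coefficients of F vanish at q = z (when
d divides n the right-hand side vanishes because [n] does). Hence F = prod (x - x_M) * G, where the
coefficients of G vanish at q = z as well. At x = 2 the factors 2 - x_M = -(1 - q^M)^2 / q^M together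
vanish, for d = n^j, to an order exceeding by two that of the common denominator
prod_(i <= K) (1 - q^(2 i))^2, and G adds one more zero. This gives order three at the roots of
Phi_(n^j), and order one at all other roots of [n^r].
*)
theory Submission
  imports Defs
begin

section \<open>The terminating sum\<close>

text \<open>Only two of the four copies of each shifted factorial are deformed. In the variable x
  the zeros a = q^M and a = q^(-M) merge into one linear factor, which becomes a square at x = 2, so
  no limit a -> 1 is taken. The undeformed copies stay in the coefficients of F as
  \<open>beta q k ^ 2\<close>. Denominators of \<open>beta\<close> vanish at roots of unity, so
  these coefficients are treated in the local ring of C(q) at z; division of F by monic linear
  factors does not leave that ring.

  The obstacle is an order d that divides n^r but is not a power of n. There the linear factors may
  vanish at z to a lower order than the denominator: for n = 15, r = 1, d = 3 and the half sum it is
  order 2 against order 4. At such z the modulus has at most a simple zero, and the matching zero of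
  the difference is obtained without F, by the same cancellation in the undeformed sums.\<close>

definition qnum :: "'a::field \<Rightarrow> nat \<Rightarrow> 'a" where
  "qnum Q m = (\<Sum>i<m. Q ^ i)"

text \<open>This is (Q;Q^2)_k / (Q^2;Q^2)_k. The field is arbitrary because the same formula is used
  over C(q) and at complex roots of unity.\<close>

definition beta :: "'a::field \<Rightarrow> nat \<Rightarrow> 'a" where
  "beta Q k = (\<Prod>i<k. (1 - Q ^ (2 * i + 1)) / (1 - Q ^ (2 * i + 2)))"

text \<open>The deformation parameter \<open>a\<close> of the creative microscope enters only through
  \<open>x = a + 1 / a\<close>, where \<open>quad q e x = (1 - a * q ^ e) * (1 - q ^ e / a)\<close>.\<close>

definition quad :: "'a::field \<Rightarrow> nat \<Rightarrow> 'a \<Rightarrow> 'a" where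
  "quad Q e x = 1 + Q ^ (2 * e) - Q ^ e * x"

text \<open>For x = a + 1/a this is (aQ;Q^2)_k (Q/a;Q^2)_k / ((aQ^2;Q^2)_k (Q^2/a;Q^2)_k).\<close>

definition rho :: "'a::field \<Rightarrow> 'a \<Rightarrow> nat \<Rightarrow> 'a" where
  "rho Q x k = (\<Prod>i<k. quad Q (2 * i + 1) x / quad Q (2 * i + 2) x)"

lemma quad_split:
  fixes y :: "'a::field"
  assumes "y \<noteq> 0"
  shows "quad Q e (y + 1 / y) = (1 - Q ^ e * y) * (1 - Q ^ e / y)"
proof -
  have "Q ^ (2 * e) = Q ^ e * Q ^ e" by (simp add: mult_2 power_add)
  then show ?thesis using assms unfolding quad_def by (simp add: field_simps)
qed

lemma quad_2: "quad Q e 2 = (1 - Q ^ e) ^ 2"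
proof -
  have "Q ^ (2 * e) = Q ^ e * Q ^ e" by (simp add: mult_2 power_add)
  then show ?thesis unfolding quad_def by (simp add: power2_eq_square algebra_simps)
qed

lemma rho_2: "rho Q 2 k = beta Q k ^ 2"
  unfolding rho_def beta_def quad_2 by (simp add: power_divide prod_power_distrib)

lemma beta_Suc: "beta Q (Suc k) = beta Q k * ((1 - Q ^ (2 * k + 1)) / (1 - Q ^ (2 * k + 2)))"
  by (simp add: beta_def)

lemma rho_Suc: "rho Q x (Suc k) = rho Q x k * (quad Q (2 * k + 1) x / quad Q (2 * k + 2) x)"
  by (simp add: rho_def)

lemma qnum_times: "(1 - Q) * qnum Q m = 1 - Q ^ m"
  unfolding qnum_def by (rule one_diff_power_eq[symmetric])

text \<open>Replacing a = y by a = q^2 y moves each of the four shifted factorials by one step, so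
  only boundary factors remain. The relation is cross-multiplied because 1 - q^(2k) / (q y) vanishes
  for y = q^(2N+1) and k = N + 1.\<close>

lemma rho_shift:
  fixes q y :: "'a::field"
  assumes y: "y \<noteq> 0" and q: "q \<noteq> 0" and e1: "\<And>i. q ^ (2 * i) * y \<noteq> 1" and e2: "\<And>i. q ^ (2 * i) \<noteq> y"
  shows "rho q (q\<^sup>2 * y + 1 / (q\<^sup>2 * y)) k * (q * (1 - y) * (1 - q ^ (2 * k) / (q * y)) * (1 - q ^ (2 * k + 2) * y))
       = (1 - q\<^sup>2 * y) * (1 - q ^ (2 * k + 1) * y) * (1 - q ^ (2 * k) / y) * rho q (y + 1 / y) k" (is "?R k * ?a k = ?b k * ?r k")
proof (induction k)
  case 0
  show ?case using y q by (simp add: rho_def field_simps power2_eq_square)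
next
  case (Suc k)
  define z where "z = q ^ (2 * k)"
  have z: "q ^ (2 * Suc k) = q\<^sup>2 * z" "q ^ (2 * k + 1) = q * z" "q ^ (2 * k + 2) = q\<^sup>2 * z"
    by (simp_all add: z_def power2_eq_square)
  have y2: "q\<^sup>2 * y \<noteq> 0" using y q by simp
  have n1: "1 - q\<^sup>2 * z * y \<noteq> 0" using e1[of "k+1"] by (simp add: z_def power2_eq_square mult.assoc)
  have n2: "1 - q\<^sup>2 * z / y \<noteq> 0" using e2[of "k+1"] y by (simp add: z_def power2_eq_square field_simps)
  have n3: "1 - z / y \<noteq> 0" using e2[of "k"] y by (simp add: z_def power2_eq_square field_simps)
  have n4: "1 - q\<^sup>2 * z * (q\<^sup>2 * y) \<noteq> 0" using e1[of "k+2"] by (simp add: z_def power2_eq_square algebra_simps)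
  have R: "?R (Suc k) = ?R k * ((1 - q * z * (q\<^sup>2 * y)) * (1 - z / (q * y)) / ((1 - q\<^sup>2 * z * (q\<^sup>2 * y)) * (1 - z / y)))"
    unfolding rho_Suc quad_split[OF y2] z using q by (simp add: power2_eq_square)
  have r: "?r (Suc k) = ?r k * ((1 - q * z * y) * (1 - q * z / y) / ((1 - q\<^sup>2 * z * y) * (1 - q\<^sup>2 * z / y)))"
    unfolding rho_Suc quad_split[OF y] z by simp
  have IH: "?R k * (q * (1 - y) * (1 - z / (q * y)) * (1 - q\<^sup>2 * z * y)) = (1 - q\<^sup>2 * y) * (1 - q * z * y) * (1 - z / y) * ?r k"
    using Suc unfolding z z_def[symmetric] .
  have c: "q ^ (2 * Suc k) / (q * y) = q * z / y" "q ^ (2 * Suc k + 2) * y = q\<^sup>2 * z * (q\<^sup>2 * y)"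
    "q ^ (2 * Suc k + 1) * y = q * z * (q\<^sup>2 * y)"
    using q by (simp_all add: z_def power2_eq_square)
  define n where "n = 1 - z / y"
  define m where "m = 1 - q\<^sup>2 * z * y"
  define l where "l = 1 - q\<^sup>2 * z * (q\<^sup>2 * y)"
  define p where "p = 1 - q\<^sup>2 * z / y"
  define t where "t = 1 - z / (q * y)"
  define u where "u = 1 - q * z * y"
  define v where "v = 1 - q * z / y"
  define w where "w = 1 - q * z * (q\<^sup>2 * y)"
  note defs = n_def[symmetric] m_def[symmetric] l_def[symmetric] p_def[symmetric] t_def[symmetric] u_def[symmetric] v_def[symmetric] w_def[symmetric]
  note nz = n1[unfolded defs] n2[unfolded defs] n3[unfolded defs] n4[unfolded defs]
  have "?R (Suc k) * ?a (Suc k) = (?R k * (q * (1 - y) * t * m)) * (w * v) / (n * m)"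
    unfolding R c defs using nz by (simp add: field_simps)
  also have "\<dots> = ((1 - q\<^sup>2 * y) * u * n * ?r k) * (w * v) / (n * m)"
    using IH unfolding defs by simp
  also have "\<dots> = ?b (Suc k) * ?r (Suc k)"
    unfolding r c z defs using nz by (simp add: field_simps)
  finally show ?case .
qed

text \<open>The factor of \<open>rho_shift\<close> that may vanish also occurs in the next quotient
  of \<open>rho\<close> and cancels. Thus even the last nonzero term for q^2 y = q^(2N+3), at index
  N + 1, is expressed by the term of index N for y.\<close>

lemma rho_shift_Suc:
  fixes q y :: "'a::field"
  assumes y: "y \<noteq> 0" and q: "q \<noteq> 0" and e1: "\<And>i. q ^ (2 * i) * y \<noteq> 1" and e2: "\<And>i. q ^ (2 * i) \<noteq> y"
  shows "rho q (q\<^sup>2 * y + 1 / (q\<^sup>2 * y)) (Suc k) = rho q (y + 1 / y) k * ((1 - q\<^sup>2 * y) * (1 - q * q ^ (2 * k) * y) * (1 - q * q ^ (2 * k) * (q\<^sup>2 * y)) /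
      (q * (1 - y) * (1 - q\<^sup>2 * q ^ (2 * k) * y) * (1 - q\<^sup>2 * q ^ (2 * k) * (q\<^sup>2 * y))))"
proof -
  define z where "z = q ^ (2 * k)"
  have z: "q ^ (2 * Suc k) = q\<^sup>2 * z" "q ^ (2 * k + 1) = q * z" "q ^ (2 * k + 2) = q\<^sup>2 * z"
    by (simp_all add: z_def power2_eq_square)
  have y2: "q\<^sup>2 * y \<noteq> 0" using y q by simp
  have n0: "1 - y \<noteq> 0" using e1[of 0] by simp
  have n1: "1 - q\<^sup>2 * z * y \<noteq> 0" using e1[of "k+1"] by (simp add: z_def power2_eq_square mult.assoc)
  have n3: "1 - z / y \<noteq> 0" using e2[of "k"] y by (simp add: z_def power2_eq_square field_simps)
  have n4: "1 - q\<^sup>2 * z * (q\<^sup>2 * y) \<noteq> 0" using e1[of "k+2"] by (simp add: z_def power2_eq_square algebra_simps)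
  let ?R = "rho q (q\<^sup>2 * y + 1 / (q\<^sup>2 * y))" and ?r = "rho q (y + 1 / y)"
  define n where "n = 1 - z / y"
  define m where "m = 1 - q\<^sup>2 * z * y"
  define l where "l = 1 - q\<^sup>2 * z * (q\<^sup>2 * y)"
  define t where "t = 1 - z / (q * y)"
  define u where "u = 1 - q * z * y"
  define w where "w = 1 - q * z * (q\<^sup>2 * y)"
  define x where "x = 1 - y"
  define s where "s = 1 - q\<^sup>2 * y"
  note defs = n_def[symmetric] m_def[symmetric] l_def[symmetric] t_def[symmetric] u_def[symmetric] w_def[symmetric] x_def[symmetric] s_def[symmetric]
  note nz = n0[unfolded defs] n1[unfolded defs] n3[unfolded defs] n4[unfolded defs]
  have R: "?R (Suc k) = ?R k * (w * t / (l * n))"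
    unfolding rho_Suc quad_split[OF y2] z l_def w_def t_def n_def using q by (simp add: power2_eq_square)
  also have "\<dots> = (?R k * (q * (1 - y) * t * m)) * w / (q * x * m * l * n)"
    unfolding defs using nz q by (simp add: field_simps)
  also have "(?R k * (q * (1 - y) * t * m)) = s * u * n * ?r k"
    using rho_shift[OF assms, of k] unfolding z z_def[symmetric] defs .
  finally show ?thesis unfolding z_def[symmetric] defs using nz q by (simp add: field_simps)
qed

text \<open>What is left of the telescoping step once common factors are removed, with w = q^(2k+1).
  The inverse i of y is a variable of its own, so that the identity is polynomial.\<close>

lemma wz_identity:
  fixes q y w i :: "'a::field"
  assumes "y * i = 1"
  shows "- (1 + q * y) * ((1 - q\<^sup>2 * w)\<^sup>2 * (1 - q\<^sup>2 * w * y) * (1 - w * i) - (1 - q * w)\<^sup>2 * (1 - q ^ 3 * w * y) * (1 - q * w * i))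
       = (1 - q * y) * ((1 - q ^ 3 * w\<^sup>2) * ((1 - q\<^sup>2 * w * y) * (1 - q * w * i) - (1 - w * i) * (1 - q ^ 3 * w * y)))"
  using assms by algebra

text \<open>A Wilf--Zeilberger pair: for \<open>y = q ^ (2 * N + 1)\<close> the summand divided by the expected
  value of the sum differs between \<open>N + 1\<close> and \<open>N\<close> by a telescoping term, whose partial sums
  are the right-hand side.\<close>

lemma wz_partial_sum:
  fixes q y :: "'a::field"
  assumes y: "y \<noteq> 0" and q: "q \<noteq> 0" and e1: "\<And>i. q ^ i * y \<noteq> 1" and e2: "\<And>i. q ^ (2 * i) \<noteq> y"
    and qr: "\<And>i. i > 0 \<Longrightarrow> q ^ i \<noteq> 1"
  shows "(\<Sum>j\<le>k. (1 - q ^ (4 * j + 1)) * beta q j ^ 2 *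
            (q / (1 - q\<^sup>2 * y) * rho q (q\<^sup>2 * y + 1 / (q\<^sup>2 * y)) j - 1 / (1 - y) * rho q (y + 1 / y) j))
    = - (1 + q * y) / (1 - q * y) * (1 - q ^ (2 * k + 1))\<^sup>2 * (1 - q ^ (2 * k + 1) * y) /
      ((1 - q ^ (2 * k + 2) * y) * (1 - y)) * beta q k ^ 2 * rho q (y + 1 / y) k"
proof (induction k)
  case 0
  have n0: "1 - y \<noteq> 0" "1 - q * y \<noteq> 0" "1 - q\<^sup>2 * y \<noteq> 0" using e1[of 0] e1[of 1] e1[of 2] by simp_all
  show ?case using n0 by (simp add: beta_def rho_def divide_simps) (simp add: algebra_simps power2_eq_square)
next
  case (Suc k)
  define w where "w = q ^ (2 * k + 1)"
  define i where "i = 1 / y"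
  have yi: "y * i = 1" using y by (simp add: i_def)
  have n: "1 - y \<noteq> 0" "1 - q * y \<noteq> 0" "1 - q\<^sup>2 * y \<noteq> 0" using e1[of 0] e1[of 1] e1[of 2] by simp_all
  have n1: "1 - q * w * y \<noteq> 0" using e1[of "2*k+2"] by (simp add: w_def mult.assoc)
  have n2: "1 - q * w * i \<noteq> 0" using e2[of "k+1"] y by (simp add: w_def i_def mult.assoc field_simps)
  have n4: "1 - q ^ 3 * w * y \<noteq> 0" using e1[of "2*k+4"] by (simp add: w_def eval_nat_numeral algebra_simps)
  have n5: "1 - q * w \<noteq> 0" using qr[of "2*k+2"] by (simp add: w_def)
  let ?R = "rho q (q\<^sup>2 * y + 1 / (q\<^sup>2 * y))" and ?r = "rho q (y + 1 / y)"
  have e: "q ^ (2 * k + 1) = w" "q ^ (2 * k + 2) = q * w" "q ^ (2 * Suc k + 1) = q\<^sup>2 * w" "q ^ (2 * Suc k + 2) = q ^ 3 * w"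
     "q * q ^ (2 * k) = w" "q\<^sup>2 * q ^ (2 * k) = q * w"
    by (simp_all add: w_def power_add power_mult power2_eq_square power3_eq_cube algebra_simps)
  have e': "q ^ (4 * Suc k + 1) = q ^ 3 * w\<^sup>2"
    unfolding w_def power_mult[symmetric] power_add[symmetric] by (rule arg_cong[of _ _ "power q"]) simp
  have R: "?R (Suc k) = ?r k * ((1 - q\<^sup>2 * y) * (1 - w * y) * (1 - q\<^sup>2 * w * y) /
      (q * (1 - y) * (1 - q * w * y) * (1 - q ^ 3 * w * y)))"
  proof -
    have *: "q\<^sup>2 * q ^ (2 * k) * (q\<^sup>2 * y) = q ^ 3 * w * y" "q * q ^ (2 * k) * y = w * y"
      "q * q ^ (2 * k) * (q\<^sup>2 * y) = q\<^sup>2 * w * y" "q\<^sup>2 * q ^ (2 * k) * y = q * w * y"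
      by (simp_all add: w_def power2_eq_square power3_eq_cube)
    show ?thesis using rho_shift_Suc[OF y q e1 e2, of k] unfolding * .
  qed
  have rr: "?r (Suc k) = ?r k * ((1 - w * y) * (1 - w * i) / ((1 - q * w * y) * (1 - q * w * i)))"
    unfolding rho_Suc quad_split[OF y] e i_def by simp
  have be: "beta q (Suc k) = beta q k * ((1 - w) / (1 - q * w))"
    unfolding beta_Suc e ..
  define x0 where "x0 = 1 - y"
  define x1 where "x1 = 1 - q * y"
  define x2 where "x2 = 1 - q\<^sup>2 * y"
  define m1 where "m1 = 1 - q * w * y"
  define m2 where "m2 = 1 - q * w * i"
  define m4 where "m4 = 1 - q ^ 3 * w * y"
  define m5 where "m5 = 1 - q * w"
  define a where "a = 1 - w * y"
  define b where "b = 1 - w * i"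
  define c where "c = 1 - q\<^sup>2 * w * y"
  define d where "d = 1 - q\<^sup>2 * w"
  define f where "f = 1 - w"
  define g where "g = 1 - q ^ 3 * w\<^sup>2"
  define h where "h = 1 + q * y"
  note defs = x0_def[symmetric] x1_def[symmetric] x2_def[symmetric] m1_def[symmetric] m2_def[symmetric] m4_def[symmetric] m5_def[symmetric]
    a_def[symmetric] b_def[symmetric] c_def[symmetric] d_def[symmetric] f_def[symmetric] g_def[symmetric] h_def[symmetric]
  note nz = n[unfolded defs] n1[unfolded defs] n2[unfolded defs] n4[unfolded defs] n5[unfolded defs]
  define B where "B = beta q k"
  define r where "r = ?r k"
  \<comment> \<open>\<open>C\<close> collects what the summand at k + 1 and the boundary terms at k
    and k + 1 have in common; the remaining factors are those of \<open>wz_identity\<close>.\<close>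
  define C where "C = B\<^sup>2 * r * f\<^sup>2 * a / (m5\<^sup>2 * x0 * m1 * m2 * m4)"
  have S: "(1 - q ^ (4 * Suc k + 1)) * beta q (Suc k) ^ 2 * (q / (1 - q\<^sup>2 * y) * ?R (Suc k) - 1 / (1 - y) * ?r (Suc k))
     = C * (g * (c * m2 - b * m4))"
    (is "?S = _")
    unfolding be e e' R rr defs B_def[symmetric] r_def[symmetric] C_def using nz q by (simp add: field_simps power2_eq_square)
  have T1: "- (1 + q * y) / (1 - q * y) * (1 - q ^ (2 * k + 1))\<^sup>2 * (1 - q ^ (2 * k + 1) * y) /
      ((1 - q ^ (2 * k + 2) * y) * (1 - y)) * beta q k ^ 2 * ?r k
      = C * (- h * (m5\<^sup>2 * m4 * m2)) / x1"
    (is "?T k = _") unfolding e defs B_def[symmetric] r_def[symmetric] C_def using nz by (simp add: field_simps)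
  have T2: "?T (Suc k) = C * (- h * (d\<^sup>2 * c * b)) / x1"
    unfolding e rr be defs B_def[symmetric] r_def[symmetric] C_def using nz by (simp add: field_simps)
  have "?T (Suc k) - ?T k = C * (- h * (d\<^sup>2 * c * b - m5\<^sup>2 * m4 * m2)) / x1"
    unfolding T1 T2 by (simp add: diff_divide_distrib right_diff_distrib)
  also have "\<dots> = ?S" unfolding S wz_identity[OF yi, of q w, unfolded defs] using nz by simp
  finally have "?T (Suc k) = ?T k + ?S" by (simp add: algebra_simps)
  then show ?case unfolding sum.atMost_Suc Suc by simp
qed

lemma rho_eq_0:
  assumes "quad Q (2 * i + 1) x = 0" "i < k"
  shows "rho Q x k = 0"
  unfolding rho_def using assms by (intro prod_zero) auto

text \<open>Induction on N with the telescoping pair at y = q^(2N+1): since K > N, the boundary term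
  contains \<open>rho\<close> at an index where it is already zero, so the normalised sums for N and
  N + 1 agree. Only the term k = 0 survives for N = 0. Any K from N on gives the same value, which
  serves both truncations.\<close>

lemma terminating_sum:
  fixes q :: "'a::field"
  assumes q: "q \<noteq> 0" and qr: "\<And>i. i > 0 \<Longrightarrow> q ^ i \<noteq> 1" and "N \<le> K"
  shows "(\<Sum>k\<le>K. qnum q (4 * k + 1) * beta q k ^ 2 * rho q (q ^ (2 * N + 1) + 1 / q ^ (2 * N + 1)) k)
       = qnum q (2 * N + 1) / q ^ N"
proof -
  have "(\<Sum>k\<le>K. (1 - q ^ (4 * k + 1)) * beta q k ^ 2 * rho q (q ^ (2 * N + 1) + 1 / q ^ (2 * N + 1)) k)
       = (1 - q ^ (2 * N + 1)) / q ^ N"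
    using \<open>N \<le> K\<close>
  proof (induction N)
    case 0
    have "rho q (q ^ (2 * 0 + 1) + 1 / q ^ (2 * 0 + 1)) k = 0" if "k > 0" for k
      using q that by (intro rho_eq_0[of _ 0]) (simp_all add: quad_split del: power_Suc)
    then have "(\<Sum>k\<le>K. (1 - q ^ (4 * k + 1)) * beta q k ^ 2 * rho q (q ^ (2 * 0 + 1) + 1 / q ^ (2 * 0 + 1)) k)
       = (\<Sum>k\<in>{0}. (1 - q ^ (4 * k + 1)) * beta q k ^ 2 * rho q (q ^ (2 * 0 + 1) + 1 / q ^ (2 * 0 + 1)) k)"
      by (intro sum.mono_neutral_right) auto
    then show ?case by (simp add: beta_def rho_def)
  next
    case (Suc N)
    define y where "y = q ^ (2 * N + 1)"
    have y: "y \<noteq> 0" "q ^ (2 * Suc N + 1) = q\<^sup>2 * y" using q by (auto simp: y_def power2_eq_square)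
    have e1: "q ^ i * y \<noteq> 1" for i unfolding y_def power_add[symmetric] by (rule qr) simp
    have e2: "q ^ (2 * i) \<noteq> y" for i
    proof
      assume *: "q ^ (2 * i) = y"
      show False
      proof (cases "2 * i \<le> 2 * N + 1")
        case True
        then have "y = q ^ (2 * i) * q ^ (2 * N + 1 - 2 * i)" unfolding y_def by (simp flip: power_add)
        with * q have "q ^ (2 * N + 1 - 2 * i) = 1" by (metis mult_cancel_left1 power_eq_0_iff)
        moreover have "2 * N + 1 - 2 * i > 0" using True by presburger
        ultimately show False using qr by blast
      next
        case False
        then have "q ^ (2 * i) = y * q ^ (2 * i - (2 * N + 1))" by (simp only: y_def power_add[symmetric]) simp
        with * y(1) have "q ^ (2 * i - (2 * N + 1)) = 1" by (metis mult_cancel_left1)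
        moreover have "2 * i - (2 * N + 1) > 0" using False by presburger
        ultimately show False using qr by blast
      qed
    qed
    have n: "1 - y \<noteq> 0" "1 - q\<^sup>2 * y \<noteq> 0" using e1[of 0] e1[of 2] by simp_all
    have z: "rho q (y + 1 / y) K = 0"
      using y Suc.prems by (intro rho_eq_0[of _ N]) (simp_all add: quad_split, simp add: y_def)
    let ?t = "\<lambda>y k. (1 - q ^ (4 * k + 1)) * beta q k ^ 2 * rho q (y + 1 / y) k"
    have "q / (1 - q\<^sup>2 * y) * (\<Sum>k\<le>K. ?t (q\<^sup>2 * y) k) - 1 / (1 - y) * (\<Sum>k\<le>K. ?t y k) = 0"
    proof -
      have "q / (1 - q\<^sup>2 * y) * (\<Sum>k\<le>K. ?t (q\<^sup>2 * y) k) - 1 / (1 - y) * (\<Sum>k\<le>K. ?t y k)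
        = (\<Sum>j\<le>K. (1 - q ^ (4 * j + 1)) * beta q j ^ 2 *
            (q / (1 - q\<^sup>2 * y) * rho q (q\<^sup>2 * y + 1 / (q\<^sup>2 * y)) j - 1 / (1 - y) * rho q (y + 1 / y) j))"
        unfolding sum_distrib_left sum_subtractf[symmetric] right_diff_distrib
        by (simp only: mult.left_commute mult.assoc mult.commute)
      also have "\<dots> = 0" using wz_partial_sum[OF y(1) q e1 e2 qr, of K] unfolding z by simp
      finally show ?thesis .
    qed
    moreover have "(\<Sum>k\<le>K. ?t y k) = (1 - y) / q ^ N" using Suc by (simp add: y_def)
    ultimately have "q / (1 - q\<^sup>2 * y) * (\<Sum>k\<le>K. ?t (q\<^sup>2 * y) k) = 1 / q ^ N" using n by simp
    then have "(\<Sum>k\<le>K. ?t (q\<^sup>2 * y) k) = (1 - q\<^sup>2 * y) / q ^ Suc N"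
      using q n by (simp add: field_simps)
    then show ?case unfolding y(2) .
  qed
  then have "(1 - q) * (\<Sum>k\<le>K. qnum q (4 * k + 1) * beta q k ^ 2 * rho q (q ^ (2 * N + 1) + 1 / q ^ (2 * N + 1)) k)
      = (1 - q) * (qnum q (2 * N + 1) / q ^ N)"
    unfolding qnum_times[symmetric] mult.assoc sum_distrib_left[symmetric] times_divide_eq_right[symmetric] .
  moreover have "1 - q \<noteq> 0" using qr[of 1] by simp
  ultimately show ?thesis using mult_left_cancel by blast
qed

section \<open>Cancellation at roots of unity\<close>

definition prim_root :: "'a::field \<Rightarrow> nat \<Rightarrow> bool" where
  "prim_root w d \<longleftrightarrow> d > 0 \<and> (\<forall>i. w ^ i = 1 \<longleftrightarrow> d dvd i)"

text \<open>The upper summation limits of the two congruences, treated uniformly.\<close>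

definition trunc :: "bool \<Rightarrow> nat \<Rightarrow> nat" where
  "trunc b N = (if b then N - 1 else (N - 1) div 2)"

text \<open>With k = d m + s, either range of summation consists of \<open>trunc b e\<close> full
  periods and one partial period that is truncated in the same way. This lets both congruences share
  one proof.\<close>

lemma trunc_mult:
  assumes "odd d" "odd e"
  shows "trunc b (d * e) = d * trunc b e + trunc b d"
proof -
  obtain h k where "d = 2 * h + 1" "e = 2 * k + 1" using assms by (auto elim!: oddE)
  then show ?thesis by (auto simp: trunc_def algebra_simps)
qed

lemma prim_rootD: "prim_root w d \<Longrightarrow> w ^ i = 1 \<longleftrightarrow> d dvd i"
  by (simp add: prim_root_def)

lemma prim_root_nz: "prim_root w d \<Longrightarrow> w \<noteq> 0"
proof
  assume p: "prim_root w d" and "w = 0"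
  then have "w ^ d = 0" by (simp add: prim_root_def)
  then show False using prim_rootD[OF p, of d] by (metis dvd_refl zero_neq_one)
qed

lemma prim_root_pow_mult: "prim_root w d \<Longrightarrow> w ^ (d * m) = 1"
  by (simp add: prim_rootD)

lemma prim_root_exists:
  assumes "z ^ N = 1" "N > 0"
  obtains d where "prim_root z d" "d dvd N"
proof -
  define d where "d = (LEAST d. d > 0 \<and> z ^ d = 1)"
  have d: "d > 0" "z ^ d = 1" using LeastI[of "\<lambda>d. d > 0 \<and> z ^ d = 1" N] assms by (auto simp: d_def)
  have "z ^ i = 1 \<longleftrightarrow> d dvd i" for i
  proof
    assume i: "z ^ i = 1"
    have "z ^ i = (z ^ d) ^ (i div d) * z ^ (i mod d)"
      by (simp only: power_mult[symmetric] power_add[symmetric] mult_div_mod_eq)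
    then have "z ^ (i mod d) = 1" using i d by simp
    moreover have "i mod d < d" using d by simp
    ultimately have "i mod d = 0"
      using not_less_Least[of "i mod d" "\<lambda>d. d > 0 \<and> z ^ d = 1"] by (simp flip: d_def)
    then show "d dvd i" by auto
  next
    assume "d dvd i"
    then show "z ^ i = 1" using d by (auto simp: power_mult elim!: dvdE)
  qed
  then have "prim_root z d" using d by (simp add: prim_root_def)
  with that assms show ?thesis by (auto simp: prim_root_def)
qed

lemma quad_periodic:
  assumes "prim_root w d"
  shows "quad w (d * m + e) x = quad w e x"
proof -
  have "w ^ (d * m + e) = w ^ e" "w ^ (2 * (d * m + e)) = w ^ (2 * e)"
    using prim_root_pow_mult[OF assms, of m] prim_root_pow_mult[OF assms, of "m * 2"]
    by (simp_all add: power_add algebra_simps)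
  then show ?thesis by (simp add: quad_def)
qed

text \<open>As a polynomial in w^e, \<open>quad\<close> is palindromic, and w^(d-e) is the inverse
  of w^e.\<close>

lemma quad_reflect:
  assumes "prim_root w d" "e \<le> d"
  shows "quad w (d - e) x = quad w e x / w ^ (2 * e)"
proof -
  have 1: "w ^ (d - e) * w ^ e = 1" using assms by (simp add: power_add[symmetric] prim_rootD)
  have 2: "w ^ (2 * t) = w ^ t * w ^ t" for t by (simp add: mult_2 power_add)
  define a where "a = w ^ (d - e)"
  define b where "b = w ^ e"
  have "b \<noteq> 0" using prim_root_nz[OF assms(1)] by (simp add: b_def)
  have ab: "a * b = 1" using 1 by (simp add: a_def b_def)
  then have "(1 + a * a - a * x) * (b * b) = 1 + b * b - b * x" by algebra
  then show ?thesis unfolding quad_def 2 a_def[symmetric] b_def[symmetric]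
    using \<open>b \<noteq> 0\<close> by (simp add: field_simps)
qed

text \<open>As d is odd, e -> d - e exchanges odd and even exponents. The factors removed from the
  end of \<open>rho w x h\<close> are therefore, up to powers of w, the inverses of those at its
  beginning.\<close>

lemma rho_reflect:
  assumes p: "prim_root w d" and d: "d = 2 * h + 1" and nz: "\<And>e. 0 < e \<Longrightarrow> e < d \<Longrightarrow> quad w e x \<noteq> 0"
    and "s \<le> h"
  shows "rho w x (h - s) = rho w x h * w ^ (2 * s) * rho w x s"
  using \<open>s \<le> h\<close>
proof (induction s)
  case 0
  show ?case by (simp add: rho_def)
next
  case (Suc s)
  have e: "2 * (h - Suc s) + 1 = d - (2 * s + 2)" "2 * (h - Suc s) + 2 = d - (2 * s + 1)" "Suc (h - Suc s) = h - s"
    using Suc.prems d by auto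
  have w: "w \<noteq> 0" using prim_root_nz[OF p] .
  have n: "quad w (2 * s + 1) x \<noteq> 0" "quad w (2 * s + 2) x \<noteq> 0"
    using Suc.prems d by (intro nz; simp)+
  have "rho w x (h - s) = rho w x (h - Suc s) * (quad w (d - (2 * s + 2)) x / quad w (d - (2 * s + 1)) x)"
    using rho_Suc[of w x "h - Suc s"] unfolding e .
  also have "quad w (d - (2 * s + 2)) x / quad w (d - (2 * s + 1)) x = quad w (2 * s + 2) x / quad w (2 * s + 1) x / w\<^sup>2"
  proof -
    have le: "2 * s + 2 \<le> d" "2 * s + 1 \<le> d" using Suc.prems d by auto
    have "w ^ (2 * (2 * s + 2)) = w ^ (2 * (2 * s + 1)) * w\<^sup>2" by (simp add: power2_eq_square)
    then show ?thesis unfolding quad_reflect[OF p le(1)] quad_reflect[OF p le(2)] using w by (simp add: field_simps)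
  qed
  finally have "rho w x (h - Suc s) = rho w x (h - s) * w\<^sup>2 * (quad w (2 * s + 1) x / quad w (2 * s + 2) x)"
    using n w by (simp add: field_simps)
  also have "\<dots> = rho w x h * w ^ (2 * Suc s) * rho w x (Suc s)"
    using Suc by (simp add: rho_Suc power2_eq_square)
  finally show ?case .
qed

text \<open>The numerator runs over all odd exponents below d, the denominator over all even ones.
  Reflection matches them, so only a power of w remains and the value does not depend on x.\<close>

lemma rho_half:
  assumes p: "prim_root w d" and d: "d = 2 * h + 1" and nz: "\<And>e. 0 < e \<Longrightarrow> e < d \<Longrightarrow> quad w e x \<noteq> 0"
  shows "rho w x h * w ^ (2 * h * (h + 1)) = 1"
proof -
  have w: "w \<noteq> 0" using prim_root_nz[OF p] .
  have s: "(\<Prod>i<k. w ^ (4 * i + 4)) = w ^ (2 * k * (k + 1))" for k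
  proof (induction k)
    case (Suc k)
    have "2 * Suc k * (Suc k + 1) = 2 * k * (k + 1) + (4 * k + 4)" by (simp add: algebra_simps)
    then show ?case using Suc by (simp only: power_add prod.lessThan_Suc)
  qed simp
  have "(\<Prod>i<h. quad w (2 * i + 1) x) = (\<Prod>i<h. quad w (2 * (h - Suc i) + 1) x)"
    by (rule prod.nat_diff_reindex[symmetric])
  also have "\<dots> = (\<Prod>i<h. quad w (2 * i + 2) x / w ^ (4 * i + 4))"
  proof (rule prod.cong[OF refl])
    fix i assume "i \<in> {..<h}"
    then have "2 * (h - Suc i) + 1 = d - (2 * i + 2)" "2 * i + 2 \<le> d" using d by auto
    moreover have "2 * (2 * i + 2) = 4 * i + 4" by simp
    ultimately show "quad w (2 * (h - Suc i) + 1) x = quad w (2 * i + 2) x / w ^ (4 * i + 4)"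
      using quad_reflect[OF p, of "2 * i + 2" x] by metis
  qed
  also have "\<dots> = (\<Prod>i<h. quad w (2 * i + 2) x) / w ^ (2 * h * (h + 1))"
    unfolding prod_dividef s ..
  finally have "rho w x h = (\<Prod>i<h. quad w (2 * i + 2) x) / w ^ (2 * h * (h + 1)) / (\<Prod>i<h. quad w (2 * i + 2) x)"
    by (simp add: rho_def prod_dividef)
  moreover have "quad w (2 * i + 2) x \<noteq> 0" if "i < h" for i
    using that d by (intro nz) simp_all
  then have "(\<Prod>i<h. quad w (2 * i + 2) x) \<noteq> 0" by (simp add: prod_zero_iff)
  ultimately show ?thesis using w by (simp add: field_simps)
qed

text \<open>The summand is antisymmetric under s -> h - s. Two independent parameters are used
  because the deformed factor is multiplied by \<open>beta w s ^ 2\<close>, which is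
  \<open>rho w 2 s\<close>.\<close>

lemma half_period_sum:
  fixes w :: complex
  assumes p: "prim_root w d" and d: "d = 2 * h + 1"
    and nzx: "\<And>e. 0 < e \<Longrightarrow> e < d \<Longrightarrow> quad w e x \<noteq> 0" and nzy: "\<And>e. 0 < e \<Longrightarrow> e < d \<Longrightarrow> quad w e y \<noteq> 0"
  shows "(\<Sum>s\<le>h. (1 - w ^ (4 * s + 1)) * rho w x s * rho w y s) = 0" (is "sum ?T _ = 0")
proof -
  \<comment> \<open>Since 4 h (h + 1) = d^2 - 1, the product of the two end values of
    \<open>rho\<close> is w.\<close>
  have "2 * h * (h + 1) + 2 * h * (h + 1) + 1 = d * d" unfolding d by (simp add: algebra_simps)
  then have "w ^ (2 * h * (h + 1)) * w ^ (2 * h * (h + 1)) * w = 1"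
    using prim_root_pow_mult[OF p, of d] by (simp only: power_add[symmetric] power_Suc2[symmetric] Suc_eq_plus1)
  moreover have "rho w x h * w ^ (2 * h * (h + 1)) * (rho w y h * w ^ (2 * h * (h + 1))) = 1"
    using rho_half[OF p d nzx] rho_half[OF p d nzy] by simp
  moreover define u where "u = w ^ (2 * h * (h + 1))"
  ultimately have "u * u * w = 1" "rho w x h * u * (rho w y h * u) = 1" unfolding u_def[symmetric] by blast+
  then have h: "rho w x h * rho w y h = w" by algebra
  have T: "?T (h - s) = - ?T s" if "s \<le> h" for s
  proof -
    have *: "(1 - w ^ (4 * (h - s) + 1)) * w ^ (4 * s + 1) = w ^ (4 * s + 1) - 1"
    proof -
      have "4 * (h - s) + 1 + (4 * s + 1) = d * 2" using that d by simp
      then have "w ^ (4 * (h - s) + 1) * w ^ (4 * s + 1) = 1" unfolding power_add[symmetric] using prim_root_pow_mult[OF p] by metis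
      then show ?thesis by (simp add: algebra_simps)
    qed
    have "w ^ (4 * s + 1) = w * w ^ (2 * s) * w ^ (2 * s)" by (simp add: power_add[symmetric] mult.assoc)
    moreover have "?T (h - s) = (1 - w ^ (4 * (h - s) + 1)) * ((rho w x h * rho w y h) * w ^ (2 * s) * w ^ (2 * s)) * rho w x s * rho w y s"
    proof -
      have "rho w x (h - s) = rho w x h * w ^ (2 * s) * rho w x s" "rho w y (h - s) = rho w y h * w ^ (2 * s) * rho w y s"
        using rho_reflect[OF p d _ that] nzx nzy by blast+
      then show ?thesis by (simp only: mult.assoc mult.left_commute mult.commute)
    qed
    ultimately have "?T (h - s) = ((1 - w ^ (4 * (h - s) + 1)) * w ^ (4 * s + 1)) * rho w x s * rho w y s"
      unfolding h by (simp only:)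
    also have "\<dots> = - ?T s" unfolding * by (simp add: algebra_simps)
    finally show ?thesis .
  qed
  have "sum ?T {..h} = (\<Sum>s\<le>h. ?T (h - s))"
    using sum.atLeastAtMost_rev[of ?T 0 h] by (simp add: atMost_atLeast0)
  also have "\<dots> = - sum ?T {..h}" unfolding sum_negf[symmetric] by (intro sum.cong refl T) simp
  finally show ?thesis by (simp add: eq_neg_iff_add_eq_0 flip: mult_2)
qed

lemma sum_lessThan_add: "(\<Sum>i<a + b. f i) = (\<Sum>i<a. f i) + (\<Sum>i<b. f (a + i) :: 'a::comm_monoid_add)" for a b :: nat
  by (induction b) (simp_all add: add.assoc)

lemma sum_div_mod:
  fixes f g :: "nat \<Rightarrow> 'a::comm_ring_1"
  assumes "t < d"
  shows "(\<Sum>k\<le>d * M + t. g (k div d) * f (k mod d)) = (\<Sum>m<M. g m) * (\<Sum>s<d. f s) + g M * (\<Sum>s\<le>t. f s)"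
proof -
  have b: "(\<Sum>s<l. g ((d * m + s) div d) * f ((d * m + s) mod d)) = g m * (\<Sum>s<l. f s)" if "l \<le> d" for m l
    unfolding sum_distrib_left using that assms by (intro sum.cong) auto
  have "(\<Sum>k<d * M. g (k div d) * f (k mod d)) = (\<Sum>m<M. g m) * (\<Sum>s<d. f s)"
  proof (induction M)
    case (Suc M)
    have "(\<Sum>k<d * Suc M. g (k div d) * f (k mod d)) = (\<Sum>k<d * M + d. g (k div d) * f (k mod d))"
      by (simp add: add.commute)
    then show ?case unfolding sum_lessThan_add Suc b[OF order_refl] by (simp add: distrib_right)
  qed simp
  then show ?thesis
    using sum_lessThan_add[of "\<lambda>k. g (k div d) * f (k mod d)" "d * M" "Suc t"] b[of "Suc t" M] assms
    by (simp only: add_Suc_right lessThan_Suc_atMost Suc_le_eq)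
qed

lemma beta_eq_0:
  assumes "prim_root w d" "d = 2 * h + 1" "h < s"
  shows "beta w s = 0"
proof -
  have "w ^ (2 * h + 1) = 1" using assms by (simp only: prim_rootD[OF assms(1)] dvd_refl)
  then show ?thesis unfolding beta_def using assms(3) by (intro prod_zero bexI[of _ h]) auto
qed

lemma rho_add:
  assumes "prim_root w d"
  shows "rho w x (d * m + s) = rho w x (d * m) * rho w x s"
proof (induction s)
  case 0 show ?case by (simp add: rho_def)
next
  case (Suc s)
  have "2 * (d * m + s) + 1 = d * (2 * m) + (2 * s + 1)" "2 * (d * m + s) + 2 = d * (2 * m) + (2 * s + 2)"
    by (simp_all add: algebra_simps)
  then show ?case using Suc by (simp only: add_Suc_right rho_Suc quad_periodic[OF assms] mult.assoc)
qed

lemma qnum_periodic: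
  assumes "prim_root w d" "d > 1"
  shows "qnum w (4 * (d * m + s) + 1) = qnum w (4 * s + 1)"
proof -
  have "4 * (d * m + s) + 1 = d * (4 * m) + (4 * s + 1)" by (simp add: algebra_simps)
  then have "w ^ (4 * (d * m + s) + 1) = w ^ (4 * s + 1)"
    using prim_root_pow_mult[OF assms(1)] by (simp only: power_add mult_1)
  then have "(1 - w) * qnum w (4 * (d * m + s) + 1) = (1 - w) * qnum w (4 * s + 1)" by (simp only: qnum_times)
  moreover have "1 - w \<noteq> 0" using prim_rootD[OF assms(1), of 1] assms(2) by auto
  ultimately show ?thesis by simp
qed

text \<open>Every period contributes a constant times the same sum. Its first half is zero by
  antisymmetry, and beyond h the numerator of \<open>beta w s\<close> contains 1 - w^d = 0; hence
  the full periods and the partial one at the end all vanish.\<close>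

lemma full_sum_vanishes:
  fixes w :: complex
  assumes p: "prim_root w d" and d: "odd d" "d > 1" and M: "odd M"
    and nz: "\<And>e. 0 < e \<Longrightarrow> e < d \<Longrightarrow> quad w e x \<noteq> 0"
  shows "(\<Sum>k\<le>trunc b (d * M). c (k div d) * (qnum w (4 * (k mod d) + 1) * beta w (k mod d) ^ 2 * rho w x (k mod d))) = 0"
proof -
  obtain h where h: "d = 2 * h + 1" using d by (auto elim!: oddE)
  let ?f = "\<lambda>s. qnum w (4 * s + 1) * beta w s ^ 2 * rho w x s"
  have nz2: "quad w e 2 \<noteq> 0" if "0 < e" "e < d" for e
    unfolding quad_2 using prim_rootD[OF p, of e] that by (auto dest: dvd_imp_le)
  have "(1 - w) * (\<Sum>s\<le>h. ?f s) = (\<Sum>s\<le>h. (1 - w ^ (4 * s + 1)) * rho w 2 s * rho w x s)"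
    unfolding qnum_times[symmetric] rho_2 by (simp add: sum_distrib_left mult.assoc)
  also have "\<dots> = 0" by (rule half_period_sum[OF p h nz2 nz])
  finally have f1: "(\<Sum>s\<le>h. ?f s) = 0" using prim_rootD[OF p, of 1] d by auto
  have f2: "(\<Sum>s\<le>d - 1. ?f s) = (\<Sum>s\<le>h. ?f s)"
    by (rule sum.mono_neutral_right) (use h in \<open>auto simp: beta_eq_0[OF p h]\<close>)
  have "{..<d} = {..d - 1}" using d by auto
  then have f3: "(\<Sum>s<d. ?f s) = 0" using f1 f2 by simp
  have t: "trunc b d < d" using d by (auto simp: trunc_def)
  have f4: "(\<Sum>s\<le>trunc b d. ?f s) = 0" using f1 f2 h by (simp add: trunc_def)
  show ?thesis
    unfolding trunc_mult[OF d(1) M] sum_div_mod[OF t, where f = ?f] f3 f4 by simp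
qed

text \<open>The squared expression is the shape that residues of \<open>beta\<close> take at a root
  of unity, see \<open>red_beta\<close>. The part of \<open>rho\<close> belonging to complete
  periods depends only on \<open>k div d\<close> and joins the constant.\<close>

lemma specialised_sum_vanishes:
  fixes w :: complex
  assumes p: "prim_root w d" and d: "odd d" "d > 1" and M: "odd M"
    and nz: "\<And>e. quad w e x \<noteq> 0"
  shows "(\<Sum>k\<le>trunc b (d * M). qnum w (4 * k + 1) * (c (k div d) * beta w (k mod d)) ^ 2 * rho w x k) = 0"
proof -
  have "(\<Sum>k\<le>trunc b (d * M). qnum w (4 * k + 1) * (c (k div d) * beta w (k mod d)) ^ 2 * rho w x k)
      = (\<Sum>k\<le>trunc b (d * M). (c (k div d) ^ 2 * rho w x (d * (k div d))) * (qnum w (4 * (k mod d) + 1) * beta w (k mod d) ^ 2 * rho w x (k mod d)))"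
  proof (rule sum.cong[OF refl])
    fix k
    show "qnum w (4 * k + 1) * (c (k div d) * beta w (k mod d)) ^ 2 * rho w x k =
      (c (k div d) ^ 2 * rho w x (d * (k div d))) * (qnum w (4 * (k mod d) + 1) * beta w (k mod d) ^ 2 * rho w x (k mod d))"
      using qnum_periodic[OF p d(2), of "k div d" "k mod d"] rho_add[OF p, of x "k div d" "k mod d"]
      by (simp add: power_mult_distrib)
  qed
  also have "\<dots> = 0" using full_sum_vanishes[OF p d M nz, where c = "\<lambda>m. c m ^ 2 * rho w x (d * m)"] by simp
  finally show ?thesis .
qed

text \<open>The undeformed counterpart. It does not follow by setting x = 2 above, because
  \<open>quad w d 2\<close> is zero; instead all four copies of \<open>beta\<close> enter through
  their residues.\<close>

lemma fourth_power_sum_vanishes: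
  fixes w :: complex
  assumes p: "prim_root w d" and d: "odd d" "d > 1" and M: "odd M"
  shows "(\<Sum>k\<le>trunc b (d * M). qnum w (4 * k + 1) * (c (k div d) * beta w (k mod d)) ^ 4) = 0"
proof -
  have nz: "quad w e 2 \<noteq> 0" if "0 < e" "e < d" for e
    unfolding quad_2 using prim_rootD[OF p, of e] that by (auto dest: dvd_imp_le)
  have "(\<Sum>k\<le>trunc b (d * M). qnum w (4 * k + 1) * (c (k div d) * beta w (k mod d)) ^ 4)
      = (\<Sum>k\<le>trunc b (d * M). c (k div d) ^ 4 * (qnum w (4 * (k mod d) + 1) * beta w (k mod d) ^ 2 * rho w 2 (k mod d)))"
  proof (rule sum.cong[OF refl])
    fix k
    have "(x * y) ^ 4 = x ^ 4 * (y\<^sup>2 * y\<^sup>2)" for x y :: complex by (simp add: power_mult_distrib flip: power_add)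
    then have 4: "(c (k div d) * beta w (k mod d)) ^ 4 = c (k div d) ^ 4 * (beta w (k mod d) ^ 2 * rho w 2 (k mod d))"
      unfolding rho_2 .
    show "qnum w (4 * k + 1) * (c (k div d) * beta w (k mod d)) ^ 4 =
      c (k div d) ^ 4 * (qnum w (4 * (k mod d) + 1) * beta w (k mod d) ^ 2 * rho w 2 (k mod d))"
      using qnum_periodic[OF p d(2), of "k div d" "k mod d"]
      by (simp add: 4)
  qed
  also have "\<dots> = 0" using full_sum_vanishes[OF p d M nz, where c = "\<lambda>m. c m ^ 4"] by simp
  finally show ?thesis .
qed

section \<open>Reduction at a point\<close>

text \<open>\<open>A\<close> lies in the local ring at \<open>z\<close> and has residue \<open>c\<close> there.\<close>

definition red :: "complex \<Rightarrow> rfun \<Rightarrow> complex \<Rightarrow> bool" where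
  "red z A c \<longleftrightarrow> (\<exists>u v. poly v z \<noteq> 0 \<and> A = Fract u v \<and> c = poly u z / poly v z)"

lemma redI: "poly v z \<noteq> 0 \<Longrightarrow> red z (Fract u v) (poly u z / poly v z)"
  by (auto simp: red_def)

lemma redE:
  assumes "red z A c"
  obtains u v where "poly v z \<noteq> 0" "v \<noteq> 0" "A = Fract u v" "c = poly u z / poly v z"
  using assms unfolding red_def by (metis poly_0)

lemma red_0: "red z 0 0"
  using redI[of 1 z 0] by (simp add: Zero_fract_def)

lemma red_1: "red z 1 1"
  using redI[of 1 z 1] by (simp add: One_fract_def)

lemma red_qvar: "red z qvar z"
  using redI[of 1 z "[:0, 1:]"] by (simp add: qvar_def)

lemma red_add:
  assumes "red z A a" "red z B b"
  shows "red z (A + B) (a + b)"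
proof -
  obtain u v where A: "poly v z \<noteq> 0" "v \<noteq> 0" "A = Fract u v" "a = poly u z / poly v z" using assms(1) by (rule redE)
  obtain s t where B: "poly t z \<noteq> 0" "t \<noteq> 0" "B = Fract s t" "b = poly s z / poly t z" using assms(2) by (rule redE)
  show ?thesis unfolding A(3,4) B(3,4) using redI[of "v * t" z "u * t + s * v"] A(1,2) B(1,2) by (simp add: add_frac_eq)
qed

lemma red_mult:
  assumes "red z A a" "red z B b"
  shows "red z (A * B) (a * b)"
proof -
  obtain u v where A: "poly v z \<noteq> 0" "v \<noteq> 0" "A = Fract u v" "a = poly u z / poly v z" using assms(1) by (rule redE)
  obtain s t where B: "poly t z \<noteq> 0" "t \<noteq> 0" "B = Fract s t" "b = poly s z / poly t z" using assms(2) by (rule redE)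
  show ?thesis using redI[of "v * t" z "u * s"] A B by simp
qed

lemma red_uminus:
  assumes "red z A a"
  shows "red z (- A) (- a)"
proof -
  obtain u v where A: "poly v z \<noteq> 0" "v \<noteq> 0" "A = Fract u v" "a = poly u z / poly v z" using assms(1) by (rule redE)
  show ?thesis using redI[of v z "- u"] A by simp
qed

lemma red_diff: "red z A a \<Longrightarrow> red z B b \<Longrightarrow> red z (A - B) (a - b)"
  using red_add[of z A a "- B" "- b"] red_uminus[of z B b] by simp

lemma red_inverse:
  assumes "red z A a" "a \<noteq> 0"
  shows "red z (inverse A) (inverse a)"
proof -
  obtain u v where A: "poly v z \<noteq> 0" "v \<noteq> 0" "A = Fract u v" "a = poly u z / poly v z" using assms(1) by (rule redE)
  show ?thesis using redI[of u z v] A assms(2) by simp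
qed

lemma red_divide: "red z A a \<Longrightarrow> red z B b \<Longrightarrow> b \<noteq> 0 \<Longrightarrow> red z (A / B) (a / b)"
  using red_mult[of z A a "inverse B" "inverse b"] red_inverse[of z B b] by (simp add: divide_inverse)

lemma red_power: "red z A a \<Longrightarrow> red z (A ^ k) (a ^ k)"
  by (induction k) (auto intro: red_1 red_mult)

lemma red_sum: "(\<And>i. i \<in> I \<Longrightarrow> red z (A i) (a i)) \<Longrightarrow> red z (sum A I) (sum a I)"
  by (induction I rule: infinite_finite_induct) (auto intro: red_0 red_add)

lemma red_prod: "(\<And>i. i \<in> I \<Longrightarrow> red z (A i) (a i)) \<Longrightarrow> red z (prod A I) (prod a I)"
  by (induction I rule: infinite_finite_induct) (auto intro: red_1 red_mult)

lemma red_of_nat: "red z (of_nat n) (of_nat n)"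
  by (induction n) (auto intro: red_0 red_1 red_add)

lemma red_unique: "red z A a \<Longrightarrow> red z A b \<Longrightarrow> a = b"
proof -
  assume "red z A a" "red z A b"
  then obtain u v s t where A: "poly v z \<noteq> 0" "v \<noteq> 0" "A = Fract u v" "a = poly u z / poly v z"
    and B: "poly t z \<noteq> 0" "t \<noteq> 0" "A = Fract s t" "b = poly s z / poly t z" by (elim redE)
  have "u * t = s * v" using A(2,3) B(2,3) by (simp add: eq_fract)
  then have "poly u z * poly t z = poly s z * poly v z" by (metis poly_mult)
  then show "a = b" unfolding A(4) B(4) using A(1) B(1) by (simp add: frac_eq_eq)
qed

lemma red_nonzero: "red z A a \<Longrightarrow> a \<noteq> 0 \<Longrightarrow> A \<noteq> 0"
  using red_unique red_0 by blast

text \<open>The uniformiser q - z of the local ring at z.\<close>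

definition uni :: "complex \<Rightarrow> rfun" where
  "uni z = Fract [:- z, 1:] 1"

lemma uni_nonzero: "uni z \<noteq> 0"
  by (simp add: uni_def Zero_fract_def eq_fract)

lemma red_uni: "red z (uni z) 0"
  using redI[of 1 z "[:- z, 1:]"] by (simp add: uni_def)

lemma red_0_imp_uni_mult:
  assumes "red z A 0"
  obtains B b where "A = uni z * B" "red z B b"
proof -
  obtain u v where A: "poly v z \<noteq> 0" "v \<noteq> 0" "A = Fract u v" "0 = poly u z / poly v z" using assms(1) by (rule redE)
  then obtain w where "u = [:- z, 1:] * w" by (auto simp: poly_eq_0_iff_dvd elim!: dvdE)
  then have "A = uni z * Fract w v" using A by (simp add: uni_def)
  moreover have "red z (Fract w v) (poly w z / poly v z)" by (rule redI) fact
  ultimately show ?thesis by (rule that)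
qed

section \<open>Polynomials over the local ring\<close>

definition red_poly :: "complex \<Rightarrow> rfun poly \<Rightarrow> complex poly \<Rightarrow> bool" where
  "red_poly z F f \<longleftrightarrow> (\<forall>i. red z (coeff F i) (coeff f i))"

lemma red_poly_0: "red_poly z 0 0"
  by (simp add: red_poly_def red_0)

lemma red_poly_pCons: "red z A a \<Longrightarrow> red_poly z F f \<Longrightarrow> red_poly z (pCons A F) (pCons a f)"
  by (auto simp: red_poly_def coeff_pCons split: nat.splits)

lemma red_poly_1: "red_poly z 1 1"
  unfolding one_pCons by (intro red_poly_pCons red_1 red_poly_0)

lemma red_poly_add: "red_poly z F f \<Longrightarrow> red_poly z G g \<Longrightarrow> red_poly z (F + G) (f + g)"
  by (simp add: red_poly_def red_add)

lemma red_poly_diff: "red_poly z F f \<Longrightarrow> red_poly z G g \<Longrightarrow> red_poly z (F - G) (f - g)"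
  by (simp add: red_poly_def red_diff)

lemma red_poly_smult: "red z A a \<Longrightarrow> red_poly z F f \<Longrightarrow> red_poly z (smult A F) (smult a f)"
  by (simp add: red_poly_def red_mult)

lemma red_poly_mult: "red_poly z F f \<Longrightarrow> red_poly z G g \<Longrightarrow> red_poly z (F * G) (f * g)"
  by (auto simp: red_poly_def coeff_mult intro!: red_sum red_mult)

lemma red_poly_sum: "(\<And>i. i \<in> I \<Longrightarrow> red_poly z (F i) (f i)) \<Longrightarrow> red_poly z (sum F I) (sum f I)"
  by (induction I rule: infinite_finite_induct) (auto intro: red_poly_0 red_poly_add)

lemma red_poly_prod: "(\<And>i. i \<in> I \<Longrightarrow> red_poly z (F i) (f i)) \<Longrightarrow> red_poly z (prod F I) (prod f I)"
  by (induction I rule: infinite_finite_induct) (auto intro: red_poly_1 red_poly_mult)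

lemma red_poly_eval:
  assumes "red_poly z F f" "red z X x"
  shows "red z (poly F X) (poly f x)"
proof -
  \<comment> \<open>Reduction may lower the degree; a common bound lets both polynomials be summed
    over the same range.\<close>
  define N where "N = max (degree F) (degree f)"
  have "poly F X = (\<Sum>i\<le>N. coeff F i * X ^ i)" "poly f x = (\<Sum>i\<le>N. coeff f i * x ^ i)"
    using arg_cong[OF poly_as_sum_of_monoms'[of F N], of "\<lambda>p. poly p X"]
      arg_cong[OF poly_as_sum_of_monoms'[of f N], of "\<lambda>p. poly p x"]
    by (simp_all add: poly_sum poly_monom N_def)
  with assms show ?thesis by (auto simp: red_poly_def intro!: red_sum red_mult red_power)
qed

text \<open>The divisor is monic, so the coefficients of the quotient are recovered from the top
  degree downwards without any division.\<close>

lemma red_poly_0_cancel_root: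
  assumes F: "red_poly z ([:- X, 1:] * G) 0" and X: "red z X x"
  shows "red_poly z G 0"
proof -
  have G: "coeff G i = coeff ([:- X, 1:] * G) (Suc i) + X * coeff G (Suc i)" for i by (simp add: coeff_pCons)
  have "red z (coeff G i) 0" if "i + k = Suc (degree G)" for i k
    using that
  proof (induction k arbitrary: i)
    case 0
    then show ?case by (simp add: coeff_eq_0 red_0)
  next
    case (Suc k)
    have "red z (coeff ([:- X, 1:] * G) (Suc i) + X * coeff G (Suc i)) (0 + x * 0)"
      using F Suc.IH[of "Suc i"] Suc.prems X by (intro red_add red_mult) (auto simp: red_poly_def simp del: mult_pCons_left)
    then show ?case unfolding G[of i, symmetric] by simp
  qed
  then have "red z (coeff G i) 0" for i
    by (cases "i \<le> Suc (degree G)") (auto simp: coeff_eq_0 red_0 dest: le_Suc_ex)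
  then show ?thesis by (simp add: red_poly_def)
qed

text \<open>The roots have to be distinct only over C(q). Their residues at z may coincide, and in
  the application these coincidences produce the high order of vanishing.\<close>

lemma red_poly_0_cancel_roots:
  assumes "finite I" "inj_on X I" "red_poly z F 0" "\<And>i. i \<in> I \<Longrightarrow> poly F (X i) = 0" "\<And>i. i \<in> I \<Longrightarrow> red z (X i) (x i)"
  obtains G where "F = (\<Prod>i\<in>I. [:- X i, 1:]) * G" "red_poly z G 0"
  using assms
proof (induction I arbitrary: F thesis rule: finite_induct)
  case empty
  then show ?case by simp
next
  case (insert i I)
  obtain G where G: "F = [:- X i, 1:] * G" using insert.prems(4)[of i] by (auto simp: poly_eq_0_iff_dvd elim!: dvdE)
  have G0: "red_poly z G 0"
    by (rule red_poly_0_cancel_root[OF insert.prems(3)[unfolded G] insert.prems(5)[of i]]) simp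
  have roots: "poly G (X j) = 0" if "j \<in> I" for j
  proof -
    have "X j \<noteq> X i" using that insert.hyps insert.prems(2) by (auto simp: inj_on_def)
    moreover have "poly ([:- X i, 1:] * G) (X j) = 0" unfolding G[symmetric] using that insert.prems(4) by blast
    ultimately show ?thesis by simp
  qed
  obtain H where "G = (\<Prod>i\<in>I. [:- X i, 1:]) * H" "red_poly z H 0"
    using insert.IH[OF _ _ G0 roots] insert.prems(2,5) by (auto simp: inj_on_def)
  then show ?case using G by (intro insert.prems(1)[of H]) (simp_all only: prod.insert[OF insert.hyps] mult.assoc)
qed

section \<open>Residues of shifted factorials at roots of unity\<close>

lemma qvar_power: "qvar ^ i = Fract (monom 1 i) 1"
  by (induction i) (simp_all add: qvar_def One_fract_def monom_0 one_pCons monom_Suc)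

lemma qvar_power_neq_1: "i > 0 \<Longrightarrow> qvar ^ i \<noteq> 1"
  unfolding qvar_power One_fract_def by (simp add: eq_fract) (metis degree_1 degree_monom_eq neq0_conv one_neq_zero)

lemma qvar_nonzero: "qvar \<noteq> 0"
  by (simp add: qvar_def Zero_fract_def eq_fract)

lemma red_qnum: "red z Q w \<Longrightarrow> red z (qnum Q m) (qnum w m)"
  unfolding qnum_def by (intro red_sum red_power)

lemma qnum_of_1: "qnum 1 m = of_nat m"
  by (simp add: qnum_def)

lemma odd_dvd_double: "odd d \<Longrightarrow> d dvd 2 * i \<longleftrightarrow> d dvd (i::nat)"
  by (simp add: coprime_dvd_mult_right_iff coprime_right_2_iff_odd)

text \<open>In each period exactly one numerator factor and one denominator factor vanish at \<open>z\<close>, and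
  their common zero \<open>1 - Q ^ d\<close> cancels; only the existence of the residue matters later.\<close>

lemma red_beta_period:
  assumes Q: "red z Q w" and p: "prim_root w d" and d: "odd d" and nz: "\<And>i. i > 0 \<Longrightarrow> Q ^ i \<noteq> 1"
  shows "\<exists>c. red z (beta Q (d * m)) c"
proof (induction m)
  case 0
  show ?case using red_1 by (auto simp: beta_def)
next
  case (Suc m)
  then obtain c where c: "red z (beta Q (d * m)) c" ..
  obtain h where h: "d = 2 * h + 1" using d by (auto elim!: oddE)
  have multQ: "1 - Q ^ (d * t) = (1 - Q ^ d) * qnum (Q ^ d) t" for t
    by (simp add: qnum_times power_mult)
  have redq: "red z (qnum (Q ^ d) t) (of_nat t)" for t
    using red_qnum[OF red_power[OF Q, of d]] prim_rootD[OF p, of d] by (simp add: qnum_of_1)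
  let ?n = "\<lambda>i. 1 - Q ^ (2 * (d * m + i) + 1)" and ?e = "\<lambda>i. 1 - Q ^ (2 * (d * m + i) + 2)"
  have redd: "red z (1 - Q ^ e) (1 - w ^ e)" for e by (intro red_diff red_1 red_power Q)
  have split: "beta Q (a + b) = beta Q a * ((\<Prod>i<b. 1 - Q ^ (2 * (a + i) + 1)) / (\<Prod>i<b. 1 - Q ^ (2 * (a + i) + 2)))" for a b
    by (induction b) (simp_all add: beta_Suc)
  \<comment> \<open>The exponent is d (2m + 1) at i = h in the numerator and d (2m + 2) at i = d - 1
    in the denominator; these two factors are split off.\<close>
  have "(\<Prod>i<d. ?n i) = ?n h * (\<Prod>i\<in>{..<d} - {h}. ?n i)" by (rule prod.remove) (use h in auto)
  also have "?n h = (1 - Q ^ d) * qnum (Q ^ d) (2 * m + 1)"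
    unfolding multQ[symmetric] by (rule arg_cong[of _ _ "\<lambda>e. 1 - Q ^ e"]) (simp add: h algebra_simps)
  finally have n: "(\<Prod>i<d. ?n i) = (1 - Q ^ d) * (qnum (Q ^ d) (2 * m + 1) * (\<Prod>i\<in>{..<d} - {h}. ?n i))"
    by (simp only: mult.assoc)
  have "(\<Prod>i<d. ?e i) = ?e (d - 1) * (\<Prod>i\<in>{..<d} - {d - 1}. ?e i)" by (rule prod.remove) (use h in auto)
  also have "?e (d - 1) = (1 - Q ^ d) * qnum (Q ^ d) (2 * m + 2)"
    unfolding multQ[symmetric] by (rule arg_cong[of _ _ "\<lambda>e. 1 - Q ^ e"]) (simp add: h algebra_simps)
  finally have e: "(\<Prod>i<d. ?e i) = (1 - Q ^ d) * (qnum (Q ^ d) (2 * m + 2) * (\<Prod>i\<in>{..<d} - {d - 1}. ?e i))"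
    by (simp only: mult.assoc)
  have "1 - Q ^ d \<noteq> 0" using nz[of d] h by simp
  then have "beta Q (d * Suc m) = beta Q (d * m) * ((qnum (Q ^ d) (2 * m + 1) * (\<Prod>i\<in>{..<d} - {h}. ?n i)) /
       (qnum (Q ^ d) (2 * m + 2) * (\<Prod>i\<in>{..<d} - {d - 1}. ?e i)))"
    using split[of "d * m" d] unfolding n e by (simp add: add.commute)
  moreover have "w ^ (2 * (d * m + i) + 2) \<noteq> 1" if "i < d" "i \<noteq> d - 1" for i
  proof -
    have "2 * (d * m + i) + 2 = d * (2 * m) + 2 * (i + 1)" by (simp add: algebra_simps)
    moreover have "\<not> d dvd i + 1" using that by (auto dest: dvd_imp_le)
    ultimately have "\<not> d dvd 2 * (d * m + i) + 2" using odd_dvd_double[OF d, of "i + 1"] by (metis dvd_add_right_iff dvd_triv_left)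
    then show ?thesis using prim_rootD[OF p] by blast
  qed
  then have "of_nat (2 * m + 2) * (\<Prod>i\<in>{..<d} - {d - 1}. 1 - w ^ (2 * (d * m + i) + 2)) \<noteq> 0"
    by (auto simp: prod_zero_iff simp del: of_nat_add of_nat_mult of_nat_Suc)
  ultimately show ?case
    using red_mult[OF c red_divide[OF red_mult[OF redq red_prod[OF redd]] red_mult[OF redq red_prod[OF redd]]]]
    by metis
qed

lemma red_beta:
  assumes Q: "red z Q w" and p: "prim_root w d" and d: "odd d" and nz: "\<And>i. i > 0 \<Longrightarrow> Q ^ i \<noteq> 1"
  obtains c where "\<And>k. red z (beta Q k) (c (k div d) * beta w (k mod d))"
proof -
  obtain c where c: "\<And>m. red z (beta Q (d * m)) (c m)" using red_beta_period[OF assms] by metis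
  have "red z (beta Q (d * m + s)) (c m * beta w s)" if "s < d" for m s
    using that
  proof (induction s)
    case 0
    show ?case using c by (simp add: beta_def)
  next
    case (Suc s)
    have e: "2 * (d * m + s) + 1 = d * (2 * m) + (2 * s + 1)" "2 * (d * m + s) + 2 = d * (2 * m) + (2 * s + 2)"
      by (simp_all add: algebra_simps)
    have "\<not> d dvd s + 1" using Suc.prems by (auto dest: dvd_imp_le)
    then have "w ^ (2 * s + 2) \<noteq> 1" using odd_dvd_double[OF d, of "s + 1"] prim_rootD[OF p, of "2 * (s + 1)"] by simp
    moreover have w: "w ^ (2 * (d * m + s) + 1) = w ^ (2 * s + 1)" "w ^ (2 * (d * m + s) + 2) = w ^ (2 * s + 2)"
      unfolding e power_add[of _ "d * (2 * m)"] prim_root_pow_mult[OF p] by simp_all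
    ultimately have "red z ((1 - Q ^ (2 * (d * m + s) + 1)) / (1 - Q ^ (2 * (d * m + s) + 2))) ((1 - w ^ (2 * s + 1)) / (1 - w ^ (2 * s + 2)))"
      by (metis (no_types) Q red_diff red_divide red_1 red_power right_minus_eq)
    with Suc show ?case unfolding add_Suc_right beta_Suc mult.assoc[symmetric] by (intro red_mult) simp_all
  qed
  from this[of "k mod d" "k div d" for k] have "red z (beta Q k) (c (k div d) * beta w (k mod d))" for k
    using p by (simp add: prim_root_def)
  then show ?thesis by (rule that)
qed

section \<open>The deformed difference as a polynomial\<close>

definition quadp :: "'a::field \<Rightarrow> nat \<Rightarrow> 'a poly" where
  "quadp Q e = [:1 + Q ^ (2 * e), - (Q ^ e):]"

definition numer :: "(nat \<Rightarrow> 'a::field) \<Rightarrow> 'a \<Rightarrow> nat \<Rightarrow> 'a poly" where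
  "numer c Q K = (\<Sum>k\<le>K. smult (c k) ((\<Prod>i<k. quadp Q (2 * i + 1)) * (\<Prod>i\<in>{k..<K}. quadp Q (2 * i + 2))))"

definition denom :: "'a::field \<Rightarrow> nat \<Rightarrow> 'a poly" where
  "denom Q K = (\<Prod>i<K. quadp Q (2 * i + 2))"

lemma poly_quadp [simp]: "poly (quadp Q e) x = quad Q e x"
  by (simp add: quadp_def quad_def)

lemma poly_denom: "poly (denom Q K) x = (\<Prod>i<K. quad Q (2 * i + 2) x)"
  by (simp add: denom_def poly_prod)

lemma poly_numer:
  assumes "\<And>i. i < K \<Longrightarrow> quad Q (2 * i + 2) x \<noteq> 0"
  shows "poly (numer c Q K) x = poly (denom Q K) x * (\<Sum>k\<le>K. c k * rho Q x k)"
proof -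
  have "c k * ((\<Prod>i<k. quad Q (2 * i + 1) x) * (\<Prod>i\<in>{k..<K}. quad Q (2 * i + 2) x))
      = (\<Prod>i<K. quad Q (2 * i + 2) x) * (c k * rho Q x k)" if "k \<le> K" for k
  proof -
    have "{..<K} = {..<k} \<union> {k..<K}" using that by auto
    then have "(\<Prod>i<K. quad Q (2 * i + 2) x) = (\<Prod>i<k. quad Q (2 * i + 2) x) * (\<Prod>i\<in>{k..<K}. quad Q (2 * i + 2) x)"
      by (simp add: prod.union_disjoint ivl_disj_int)
    moreover have "(\<Prod>i<k. quad Q (2 * i + 2) x) \<noteq> 0" using assms that by (auto simp: prod_zero_iff)
    ultimately show ?thesis by (simp add: rho_def prod_dividef)
  qed
  then show ?thesis
    unfolding numer_def poly_denom poly_sum poly_prod poly_smult poly_mult poly_quadp sum_distrib_left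
    by (intro sum.cong refl) simp
qed

lemma red_quadp: "red z Q w \<Longrightarrow> red_poly z (quadp Q e) (quadp w e)"
  unfolding quadp_def by (intro red_poly_pCons red_poly_0 red_uminus red_add red_1 red_power)

lemma red_numer:
  assumes "red z Q w" "\<And>k. red z (C k) (c k)"
  shows "red_poly z (numer C Q K) (numer c w K)"
  unfolding numer_def by (intro red_poly_sum red_poly_smult red_poly_mult red_poly_prod red_quadp assms)

text \<open>For |w| = 1 the equation 1 + w^(2e) = w^e x forces |x| to be at most 2. For larger x no
  factor vanishes, the cancelling sums apply, and infinitely many zeros make the polynomial
  zero.\<close>

lemma numer_vanishes:
  fixes w :: complex
  assumes p: "prim_root w d" and d: "odd d" "d > 1" and M: "odd M"
  shows "numer (\<lambda>k. qnum w (4 * k + 1) * (c (k div d) * beta w (k mod d)) ^ 2) w (trunc b (d * M)) = 0"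
proof (rule ccontr)
  assume "numer (\<lambda>k. qnum w (4 * k + 1) * (c (k div d) * beta w (k mod d)) ^ 2) w (trunc b (d * M)) \<noteq> 0" (is "?p \<noteq> 0")
  then have fin: "finite {x. poly ?p x = 0}" by (rule poly_roots_finite)
  have "norm w ^ d = 1" using prim_rootD[OF p, of d] by (simp flip: norm_power)
  then have w: "norm w = 1" using d by (intro power_eq_imp_eq_base[of "norm w" d 1]) auto
  have "poly ?p x = 0" if "norm x > 2" for x
  proof -
    have nz: "quad w e x \<noteq> 0" for e
    proof
      assume "quad w e x = 0"
      then have "1 + w ^ (2 * e) = w ^ e * x" by (simp add: quad_def)
      then have "norm (1 + w ^ (2 * e)) = norm x" using w by (simp add: norm_mult norm_power)
      moreover have "norm (1 + w ^ (2 * e)) \<le> 2"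
        using norm_triangle_ineq[of 1 "w ^ (2 * e)"] w by (simp add: norm_power)
      ultimately show False using that by simp
    qed
    show ?thesis using poly_numer[OF nz] specialised_sum_vanishes[OF p d M nz] by simp
  qed
  then have "of_nat ` {3..} \<subseteq> {x. poly ?p x = 0}" by auto
  then have "finite (of_nat ` {3..} :: complex set)" using fin by (rule finite_subset)
  then have "finite {3::nat..}" by (rule finite_imageD) (simp add: inj_on_def)
  then show False by (simp add: infinite_Ici)
qed

lemma qnum_mult:
  assumes "q \<noteq> (1::'a::field)"
  shows "qnum q (n * m) = qnum q n * qnum (q ^ n) m"
proof -
  have "(1 - q) * qnum q (n * m) = (1 - q) * (qnum q n * qnum (q ^ n) m)"
    unfolding mult.assoc[symmetric] qnum_times by (simp add: power_mult)
  then show ?thesis using assms by simp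
qed

lemma quad_power: "quad (q ^ n) e x = quad q (n * e) x"
  by (simp add: quad_def power_mult[symmetric] mult.left_commute)

text \<open>The removed indices n (i + 1) - 1 are those with exponent n (2 i + 2). They carry the
  factors of \<open>denom (q ^ n) K'\<close>, so the right-hand sum fits over the denominator of the
  left-hand one.\<close>

definition cofactor :: "'a::field \<Rightarrow> nat \<Rightarrow> nat \<Rightarrow> nat \<Rightarrow> 'a poly" where
  "cofactor q n K K' = (\<Prod>i\<in>{..<K} - (\<lambda>i. n * (i + 1) - 1) ` {..<K'}. quadp q (2 * i + 2))"

lemma denom_factor:
  assumes "n > 0" "n * K' \<le> K"
  shows "denom q K = cofactor q n K K' * denom (q ^ n) K'"
proof -
  let ?g = "\<lambda>i. n * (i + 1) - 1"
  have inj: "inj_on ?g {..<K'}"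
  proof (rule inj_onI)
    fix i j assume "?g i = ?g j"
    moreover have "n * (i + 1) > 0" "n * (j + 1) > 0" using assms by auto
    ultimately have "n * (i + 1) = n * (j + 1)" by linarith
    then show "i = j" using assms by simp
  qed
  have sub: "?g ` {..<K'} \<subseteq> {..<K}"
  proof
    fix x assume "x \<in> ?g ` {..<K'}"
    then obtain i where i: "i < K'" "x = ?g i" by auto
    then have "n * (i + 1) \<le> n * K'" by (intro mult_le_mono2) simp
    then have "n * (i + 1) \<le> K" using assms(2) by (rule le_trans)
    moreover have "n * (i + 1) > 0" using assms(1) by simp
    ultimately show "x \<in> {..<K}" using i(2) unfolding lessThan_iff by linarith
  qed
  have "denom q K = cofactor q n K K' * (\<Prod>i\<in>?g ` {..<K'}. quadp q (2 * i + 2))"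
    unfolding denom_def cofactor_def by (rule prod.subset_diff[OF sub]) simp
  also have "(\<Prod>i\<in>?g ` {..<K'}. quadp q (2 * i + 2)) = (\<Prod>i<K'. quadp q (2 * ?g i + 2))"
    by (subst prod.reindex[OF inj]) simp
  also have "\<dots> = denom (q ^ n) K'"
    unfolding denom_def
  proof (rule prod.cong[OF refl])
    fix i
    have "n * (i + 1) > 0" using assms(1) by simp
    then have "2 * ?g i + 2 = 2 * (n * (i + 1))" by linarith
    also have "\<dots> = n * (2 * i + 2)" by simp
    finally have "2 * ?g i + 2 = n * (2 * i + 2)" .
    then show "quadp q (2 * ?g i + 2) = quadp (q ^ n) (2 * i + 2)"
      by (simp only: quadp_def power_mult[symmetric] mult.left_commute)
  qed
  finally show ?thesis .
qed

definition coef :: "'a::field \<Rightarrow> nat \<Rightarrow> 'a" where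
  "coef Q k = qnum Q (4 * k + 1) * beta Q k ^ 2"

text \<open>For odd n this is q^((1-n)/2) [n].\<close>

definition prefactor :: "'a::field \<Rightarrow> nat \<Rightarrow> 'a" where
  "prefactor q n = qnum q n / q ^ ((n - 1) div 2)"

text \<open>The difference of the two sides with \<open>(1 - q ^ (2 * i + 1)) ^ 2\<close> deformed to
  \<open>quad q (2 * i + 1) x\<close>, and likewise for even exponents, over the common denominator
  \<open>denom q K\<close>; the undeformed difference is the value at \<open>x = 2\<close>.\<close>

definition diff_poly :: "'a::field \<Rightarrow> nat \<Rightarrow> nat \<Rightarrow> nat \<Rightarrow> 'a poly" where
  "diff_poly q n K K' = numer (coef q) q K - smult (prefactor q n) (cofactor q n K K' * numer (coef (q ^ n)) (q ^ n) K')"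

lemma poly_diff_poly:
  assumes "n > 0" "n * K' \<le> K" and nz: "\<And>i. i > 0 \<Longrightarrow> quad q (2 * i) x \<noteq> 0"
  shows "poly (diff_poly q n K K') x = poly (denom q K) x *
    ((\<Sum>k\<le>K. coef q k * rho q x k) - prefactor q n * (\<Sum>k\<le>K'. coef (q ^ n) k * rho (q ^ n) x k))"
proof -
  have 1: "quad q (2 * i + 2) x \<noteq> 0" for i using nz[of "i + 1"] by simp
  have 2: "quad (q ^ n) (2 * i + 2) x \<noteq> 0" for i
    using nz[of "n * (i + 1)"] assms(1) by (simp add: quad_power algebra_simps)
  show ?thesis
    unfolding diff_poly_def poly_diff poly_smult poly_mult poly_numer[OF 1] poly_numer[OF 2] denom_factor[OF assms(1,2)]
    by (simp add: algebra_simps)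
qed

lemma powers_distinct:
  fixes q :: "'a::field"
  assumes q: "q \<noteq> 0" and qr: "\<And>i. i > 0 \<Longrightarrow> q ^ i \<noteq> 1"
  shows "q ^ a = q ^ b \<longleftrightarrow> a = b"
proof -
  have *: "a = b" if "q ^ a = q ^ b" "a \<le> b" for a b
  proof -
    have "q ^ b = q ^ a * q ^ (b - a)" using that(2) by (simp add: power_add[symmetric])
    then have "q ^ (b - a) = 1" using that q by simp
    then show ?thesis using qr[of "b - a"] that by fastforce
  qed
  show ?thesis using *[of a b] *[of b a] by (metis nle_le)
qed

text \<open>With N = n l + (n - 1)/2 the same a = q^(2N+1) = (q^n)^(2l+1) terminates both sums. The
  closed forms agree because [2N+1] = [n] [2l+1] with base q^n in the last factor, and q^N =
  q^((n-1)/2) (q^n)^l; this is the origin of the prefactor.\<close>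

lemma diff_poly_root:
  fixes q :: "'a::field"
  assumes q: "q \<noteq> 0" and qr: "\<And>i. i > 0 \<Longrightarrow> q ^ i \<noteq> 1" and n: "odd n" and K: "n * K' + (n - 1) div 2 \<le> K" and l: "l \<le> K'"
  shows "poly (diff_poly q n K K') (q ^ (n * (2 * l + 1)) + 1 / q ^ (n * (2 * l + 1))) = 0"
proof -
  define N where "N = n * l + (n - 1) div 2"
  have n0: "n > 0" using n by (rule odd_pos)
  obtain h where h: "n = 2 * h + 1" using n by (auto elim!: oddE)
  have M: "n * (2 * l + 1) = 2 * N + 1" by (simp add: N_def h algebra_simps)
  have NK: "N \<le> K"
  proof -
    have "n * l \<le> n * K'" using l by simp
    then show ?thesis using K unfolding N_def by linarith
  qed
  define x where "x = q ^ (2 * N + 1) + 1 / q ^ (2 * N + 1)"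
  have nz: "quad q (2 * i) x \<noteq> 0" if "i > 0" for i
  proof -
    have "q ^ (2 * i) * q ^ (2 * N + 1) \<noteq> 1" unfolding power_add[symmetric] by (rule qr) simp
    moreover have "2 * i \<noteq> 2 * N + 1" by presburger
    then have "q ^ (2 * i) \<noteq> q ^ (2 * N + 1)" using powers_distinct[OF q, of "2 * i" "2 * N + 1"] qr by blast
    ultimately show ?thesis using q unfolding x_def by (subst quad_split) (auto simp del: power_Suc)
  qed
  have Q: "(q ^ n) \<noteq> 0" "\<And>i. i > 0 \<Longrightarrow> (q ^ n) ^ i \<noteq> 1" using q qr n0 by (auto simp flip: power_mult)
  have "(q ^ n) ^ (2 * l + 1) = q ^ (2 * N + 1)" unfolding power_mult[symmetric] M ..
  then have s2: "(\<Sum>k\<le>K'. coef (q ^ n) k * rho (q ^ n) x k) = qnum (q ^ n) (2 * l + 1) / (q ^ n) ^ l"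
    using terminating_sum[OF Q l] by (simp only: x_def coef_def)
  have s1: "(\<Sum>k\<le>K. coef q k * rho q x k) = qnum q (2 * N + 1) / q ^ N"
    using terminating_sum[OF q qr NK] by (simp only: x_def coef_def)
  have "qnum q (2 * N + 1) = qnum q n * qnum (q ^ n) (2 * l + 1)"
    unfolding M[symmetric] by (rule qnum_mult) (use qr[of 1] in simp)
  moreover have "q ^ N = q ^ ((n - 1) div 2) * (q ^ n) ^ l" by (simp add: N_def power_add power_mult)
  ultimately have "qnum q (2 * N + 1) / q ^ N = prefactor q n * (qnum (q ^ n) (2 * l + 1) / (q ^ n) ^ l)"
    by (simp add: prefactor_def)
  then have "poly (diff_poly q n K K') x = 0"
    using poly_diff_poly[OF n0 _ nz, of K' K] K s1 s2 by simp
  then show ?thesis unfolding x_def M .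
qed

section \<open>Residues of the deformed and the undeformed difference\<close>

lemma red_prefactor:
  assumes "z \<noteq> 0"
  shows "red z (prefactor qvar n) (prefactor z n)"
  unfolding prefactor_def using assms by (intro red_divide red_qnum red_qvar red_power) auto

lemma prefactor_eq_0:
  assumes "z ^ n = 1" "z \<noteq> 1"
  shows "prefactor z n = (0::complex)"
  using qnum_times[of z n] assms by (simp add: prefactor_def)

lemma qvar_pow_pow_neq_1: "n > 0 \<Longrightarrow> i > 0 \<Longrightarrow> (qvar ^ n) ^ i \<noteq> 1"
  by (simp add: qvar_power_neq_1 flip: power_mult)

lemma red_diff_poly:
  assumes p: "prim_root z d" and d: "d dvd n ^ r" "d > 1" and n: "odd n" "r > 0"
  shows "red_poly z (diff_poly qvar n (trunc b (n ^ r)) (trunc b (n ^ (r - 1)))) 0"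
proof -
  have n0: "n > 0" using n(1) by (rule odd_pos)
  have z0: "z \<noteq> 0" using prim_root_nz[OF p] .
  have z1: "z \<noteq> 1" using prim_rootD[OF p, of 1] d by auto
  obtain M where M: "n ^ r = d * M" using d(1) by (rule dvdE)
  have odd: "odd d" "odd M" using M n by (metis even_mult_iff even_power)+
  obtain c where c: "\<And>k. red z (beta qvar k) (c (k div d) * beta z (k mod d))"
    using red_beta[OF red_qvar p odd(1) qvar_power_neq_1] by blast
  have 1: "red_poly z (numer (coef qvar) qvar (trunc b (n ^ r))) 0"
    using red_numer[of z qvar z "coef qvar" "\<lambda>k. qnum z (4 * k + 1) * (c (k div d) * beta z (k mod d)) ^ 2" "trunc b (n ^ r)"]
      numer_vanishes[OF p odd(1) d(2) odd(2), of c b]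
    unfolding coef_def M by (simp add: red_qvar red_mult red_qnum red_power c)
  define w where "w = z ^ n"
  have "z ^ n ^ r = 1" using prim_rootD[OF p] d(1) by blast
  then have "w ^ (n ^ (r - 1)) = 1" unfolding w_def power_mult[symmetric] using n(2) by (simp add: power_eq_if[of n r])
  then obtain d' where p': "prim_root w d'" and d': "d' dvd n ^ (r - 1)"
    using prim_root_exists[of w "n ^ (r - 1)"] n0 by auto
  obtain M' where M': "n ^ (r - 1) = d' * M'" using d' by (rule dvdE)
  have odd': "odd d'" "odd M'" using M' n by (metis even_mult_iff even_power)+
  have Q: "red z (qvar ^ n) w" unfolding w_def by (intro red_power red_qvar)
  obtain c' where c': "\<And>k. red z (beta (qvar ^ n) k) (c' (k div d') * beta w (k mod d'))"
    using red_beta[OF Q p' odd'(1) qvar_pow_pow_neq_1[OF n0]] by blast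
  define g where "g = numer (\<lambda>k. qnum w (4 * k + 1) * (c' (k div d') * beta w (k mod d')) ^ 2) w (trunc b (d' * M'))"
  have 2: "red_poly z (numer (coef (qvar ^ n)) (qvar ^ n) (trunc b (n ^ (r - 1)))) g"
    unfolding coef_def M' g_def by (intro red_numer red_mult red_qnum red_power Q c')
  define e where "e = cofactor z n (trunc b (n ^ r)) (trunc b (n ^ (r - 1)))"
  have 3: "red_poly z (cofactor qvar n (trunc b (n ^ r)) (trunc b (n ^ (r - 1)))) e"
    unfolding cofactor_def e_def by (intro red_poly_prod red_quadp red_qvar)
  have "prefactor z n = 0 \<or> g = 0"
  proof (cases "d' = 1")
    case True
    then have "w = 1" using prim_rootD[OF p', of 1] by simp
    then show ?thesis using prefactor_eq_0 z1 by (simp add: w_def)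
  next
    case False
    then have "d' > 1" using odd'(1) by (cases d') auto
    then show ?thesis unfolding g_def using numer_vanishes[OF p' odd'(1) _ odd'(2)] by blast
  qed
  then have 0: "0 - smult (prefactor z n) (e * g) = 0" by auto
  show ?thesis
    unfolding diff_poly_def using red_poly_diff[OF 1 red_poly_smult[OF red_prefactor[OF z0, of n] red_poly_mult[OF 3 2]]] unfolding 0 .
qed

definition dwork_diff :: "nat \<Rightarrow> nat \<Rightarrow> bool \<Rightarrow> rfun" where
  "dwork_diff n r b = (\<Sum>k\<le>trunc b (n ^ r). qnum qvar (4 * k + 1) * beta qvar k ^ 4) -
     prefactor qvar n * (\<Sum>k\<le>trunc b (n ^ (r - 1)). qnum (qvar ^ n) (4 * k + 1) * beta (qvar ^ n) k ^ 4)"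

text \<open>Shown at x = 2 directly: \<open>diff_poly\<close> carries the factor
  \<open>denom\<close>, which may itself vanish at z, so its zero residue would not be
  enough.\<close>

lemma red_dwork_diff:
  assumes p: "prim_root z d" and d: "d dvd n ^ r" "d > 1" and n: "odd n" "r > 0"
  shows "red z (dwork_diff n r b) 0"
proof -
  have n0: "n > 0" using n(1) by (rule odd_pos)
  have z0: "z \<noteq> 0" using prim_root_nz[OF p] .
  have z1: "z \<noteq> 1" using prim_rootD[OF p, of 1] d by auto
  obtain M where M: "n ^ r = d * M" using d(1) by (rule dvdE)
  have odd: "odd d" "odd M" using M n by (metis even_mult_iff even_power)+
  obtain c where c: "\<And>k. red z (beta qvar k) (c (k div d) * beta z (k mod d))"
    using red_beta[OF red_qvar p odd(1) qvar_power_neq_1] by blast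
  have "red z (\<Sum>k\<le>trunc b (n ^ r). qnum qvar (4 * k + 1) * beta qvar k ^ 4)
    (\<Sum>k\<le>trunc b (d * M). qnum z (4 * k + 1) * (c (k div d) * beta z (k mod d)) ^ 4)"
    unfolding M by (intro red_sum red_mult red_qnum red_qvar red_power c)
  then have 1: "red z (\<Sum>k\<le>trunc b (n ^ r). qnum qvar (4 * k + 1) * beta qvar k ^ 4) 0"
    unfolding fourth_power_sum_vanishes[OF p odd(1) d(2) odd(2)] .
  define w where "w = z ^ n"
  have "z ^ n ^ r = 1" using prim_rootD[OF p] d(1) by blast
  then have "w ^ (n ^ (r - 1)) = 1" unfolding w_def power_mult[symmetric] using n(2) by (simp add: power_eq_if[of n r])
  then obtain d' where p': "prim_root w d'" and d': "d' dvd n ^ (r - 1)"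
    using prim_root_exists[of w "n ^ (r - 1)"] n0 by auto
  obtain M' where M': "n ^ (r - 1) = d' * M'" using d' by (rule dvdE)
  have odd': "odd d'" "odd M'" using M' n by (metis even_mult_iff even_power)+
  have Q: "red z (qvar ^ n) w" unfolding w_def by (intro red_power red_qvar)
  obtain c' where c': "\<And>k. red z (beta (qvar ^ n) k) (c' (k div d') * beta w (k mod d'))"
    using red_beta[OF Q p' odd'(1) qvar_pow_pow_neq_1[OF n0]] by blast
  define g where "g = (\<Sum>k\<le>trunc b (d' * M'). qnum w (4 * k + 1) * (c' (k div d') * beta w (k mod d')) ^ 4)"
  have 2: "red z (\<Sum>k\<le>trunc b (n ^ (r - 1)). qnum (qvar ^ n) (4 * k + 1) * beta (qvar ^ n) k ^ 4) g"
    unfolding M' g_def by (intro red_sum red_mult red_qnum red_power Q c')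
  have "prefactor z n = 0 \<or> g = 0"
  proof (cases "d' = 1")
    case True
    then have "w = 1" using prim_rootD[OF p', of 1] by simp
    then show ?thesis using prefactor_eq_0 z1 by (simp add: w_def)
  next
    case False
    then have "d' > 1" using odd'(1) by (cases d') auto
    then show ?thesis unfolding g_def using fourth_power_sum_vanishes[OF p' odd'(1) _ odd'(2)] by blast
  qed
  then have 0: "0 - prefactor z n * g = 0" by auto
  show ?thesis
    unfolding dwork_diff_def using red_diff[OF 1 red_mult[OF red_prefactor[OF z0, of n] 2]] unfolding 0 .
qed

section \<open>Orders of vanishing\<close>

definition has_ord :: "complex \<Rightarrow> rfun \<Rightarrow> nat \<Rightarrow> bool" where
  "has_ord z A k \<longleftrightarrow> (\<exists>B c. A = uni z ^ k * B \<and> red z B c \<and> c \<noteq> 0)"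

lemma has_ord_0: "red z A c \<Longrightarrow> c \<noteq> 0 \<Longrightarrow> has_ord z A 0"
  by (auto simp: has_ord_def)

lemma has_ord_mult:
  assumes "has_ord z A k" "has_ord z B l"
  shows "has_ord z (A * B) (k + l)"
proof -
  obtain A' a where A: "A = uni z ^ k * A'" "red z A' a" "a \<noteq> 0" using assms(1) by (auto simp: has_ord_def)
  obtain B' b where B: "B = uni z ^ l * B'" "red z B' b" "b \<noteq> 0" using assms(2) by (auto simp: has_ord_def)
  have "A * B = uni z ^ (k + l) * (A' * B')" "red z (A' * B') (a * b)" "a * b \<noteq> 0"
    using A B by (auto simp: power_add intro: red_mult)
  then show ?thesis unfolding has_ord_def by blast
qed

lemma has_ord_prod: "finite I \<Longrightarrow> (\<And>i. i \<in> I \<Longrightarrow> has_ord z (A i) (k i)) \<Longrightarrow> has_ord z (prod A I) (sum k I)"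
  by (induction I rule: finite_induct) (auto intro: has_ord_mult has_ord_0 red_1)

lemma has_ord_square: "has_ord z A k \<Longrightarrow> has_ord z (A\<^sup>2) (2 * k)"
  using has_ord_mult[of z A k A k] by (simp add: power2_eq_square mult_2)

text \<open>Zeros of 1 - q^M are simple, since its derivative - M q^(M-1) is nonzero at z.\<close>

lemma has_ord_one_minus_power:
  assumes p: "prim_root z d" and M: "M > 0"
  shows "has_ord z (1 - qvar ^ M) (if d dvd M then 1 else 0)"
proof (cases "d dvd M")
  case False
  then have "red z (1 - qvar ^ M) (1 - z ^ M)" "1 - z ^ M \<noteq> 0"
    using prim_rootD[OF p, of M] by (auto intro!: red_diff red_1 red_power red_qvar)
  then show ?thesis using False by (simp add: has_ord_0)
next
  case True
  let ?p = "1 - monom 1 M :: complex poly"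
  have z: "z ^ M = 1" using prim_rootD[OF p, of M] True by simp
  then have "poly ?p z = 0" by (simp add: poly_monom)
  then obtain w where w: "?p = [:- z, 1:] * w" unfolding poly_eq_0_iff_dvd by (rule dvdE)
  have "poly (pderiv ?p) z = poly w z" unfolding w by (subst pderiv_mult) (simp add: pderiv_pCons)
  moreover have "pderiv ?p = - monom (of_nat M) (M - 1)" by (simp add: pderiv_diff pderiv_monom)
  ultimately have nz: "poly w z \<noteq> 0" using M prim_root_nz[OF p] by (auto simp: poly_monom)
  have "1 - qvar ^ M = Fract ?p 1" by (simp add: qvar_power One_fract_def)
  also have "\<dots> = uni z ^ 1 * Fract w 1" unfolding w by (simp add: uni_def)
  finally show ?thesis using True redI[of 1 z w] nz unfolding has_ord_def by auto
qed

text \<open>Counts denominator factors, whose exponents are 2 (i + 1). The remainder s < N is too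
  short to reach another multiple.\<close>

lemma card_multiples:
  assumes "N > 0" "s < N"
  shows "card {i. i < N * T + s \<and> N dvd i + 1} = T"
proof -
  let ?g = "\<lambda>t. N * (t + 1) - 1"
  have pos: "N * (t + 1) > 0" for t using assms by simp
  have "inj_on ?g {..<T}"
  proof (rule inj_onI)
    fix i j assume "?g i = ?g j"
    then have "N * (i + 1) = N * (j + 1)" using pos[of i] pos[of j] by linarith
    then show "i = j" using assms by simp
  qed
  moreover have "{i. i < N * T + s \<and> N dvd i + 1} = ?g ` {..<T}"
  proof (intro set_eqI iffI)
    fix i assume "i \<in> {i. i < N * T + s \<and> N dvd i + 1}"
    then have i: "i < N * T + s" "N dvd i + 1" by auto
    obtain t where t: "i + 1 = N * t" using i(2) by (rule dvdE)
    then have t0: "t > 0" by (cases t) auto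
    have "N * t < N * (T + 1)" using i(1) t assms by (simp add: algebra_simps)
    then have "t < T + 1" by (simp only: mult_less_cancel1)
    moreover have "i = ?g (t - 1)" using t t0 by simp
    ultimately show "i \<in> ?g ` {..<T}" using t0 by (intro image_eqI[of _ _ "t - 1"]) auto
  next
    fix i assume "i \<in> ?g ` {..<T}"
    then obtain t where t: "t < T" "i = ?g t" by auto
    then have "i + 1 = N * (t + 1)" using pos[of t] by simp
    moreover have "N * (t + 1) \<le> N * T" using t(1) by (intro mult_le_mono2) simp
    ultimately show "i \<in> {i. i < N * T + s \<and> N dvd i + 1}" by auto
  qed
  ultimately show ?thesis by (simp add: card_image)
qed

text \<open>The odd multiples of m sit at l = m t + h, the middle of each period. The condition that
  s is at least h includes the middle of the last, partial period: this is the surplus zero.\<close>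

lemma card_odd_multiples:
  assumes m: "m = 2 * h + 1" and s: "h \<le> s" "s < m"
  shows "card {l. l \<le> m * T + s \<and> m dvd 2 * l + 1} = T + 1"
proof -
  let ?g = "\<lambda>t. m * t + h"
  have "inj_on ?g {..T}" using m by (intro inj_onI) (metis Suc_eq_plus1 add_right_cancel mult_cancel1 nat.distinct(1))
  moreover have "{l. l \<le> m * T + s \<and> m dvd 2 * l + 1} = ?g ` {..T}"
  proof (intro set_eqI iffI)
    fix l assume "l \<in> {l. l \<le> m * T + s \<and> m dvd 2 * l + 1}"
    then have l: "l \<le> m * T + s" "m dvd 2 * l + 1" by auto
    obtain c where c: "2 * l + 1 = m * c" using l(2) by (rule dvdE)
    then have "odd c" by (metis even_mult_iff odd_two_times_div_two_succ dvd_triv_left even_plus_one_iff)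
    then obtain t where t: "c = 2 * t + 1" by (rule oddE)
    have lt: "l = m * t + h" using c unfolding t using m by (simp add: algebra_simps)
    then have "m * t < m * (T + 1)" using l(1) s by (simp add: algebra_simps)
    then have "t < T + 1" by (simp only: mult_less_cancel1)
    then show "l \<in> ?g ` {..T}" using lt by auto
  next
    fix l assume "l \<in> ?g ` {..T}"
    then obtain t where t: "t \<le> T" "l = m * t + h" by auto
    then have "2 * l + 1 = m * (2 * t + 1)" using m by (simp add: algebra_simps)
    then have "m dvd 2 * l + 1" by simp
    moreover have "m * t \<le> m * T" using t(1) by (rule mult_le_mono2)
    then have "l \<le> m * T + s" using t s by linarith
    ultimately show "l \<in> {l. l \<le> m * T + s \<and> m dvd 2 * l + 1}" by auto
  qed
  ultimately show ?thesis by (simp add: card_image)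
qed

lemma poly_diff_poly_2:
  assumes "n > 0" "n * trunc b (n ^ (r - 1)) \<le> trunc b (n ^ r)"
  shows "poly (diff_poly qvar n (trunc b (n ^ r)) (trunc b (n ^ (r - 1)))) 2
       = poly (denom qvar (trunc b (n ^ r))) 2 * dwork_diff n r b"
proof -
  have 4: "a ^ 4 = a\<^sup>2 * a\<^sup>2" for a :: rfun by (simp flip: power_add)
  have nz: "quad qvar (2 * i) 2 \<noteq> 0" if "i > 0" for i
    unfolding quad_2 using qvar_power_neq_1[of "2 * i"] that by simp
  have "poly (diff_poly qvar n (trunc b (n ^ r)) (trunc b (n ^ (r - 1)))) 2
    = poly (denom qvar (trunc b (n ^ r))) 2 * ((\<Sum>k\<le>trunc b (n ^ r). coef qvar k * rho qvar 2 k) -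
      prefactor qvar n * (\<Sum>k\<le>trunc b (n ^ (r - 1)). coef (qvar ^ n) k * rho (qvar ^ n) 2 k))"
    using nz by (rule poly_diff_poly[OF assms])
  then show ?thesis unfolding dwork_diff_def coef_def rho_2 4 mult.assoc .
qed

text \<open>Dividing the deformed difference by its \<open>K' + 1\<close> known linear factors keeps its coefficients
  in the maximal ideal. At \<open>x = 2\<close> the linear factors contribute \<open>2 * (T + 1)\<close> zeros against the
  \<open>2 * T\<close> of the denominator, which leaves order three.\<close>

lemma triple_vanishing:
  assumes p: "prim_root z (n ^ j)" and j: "1 \<le> j" "j \<le> r" and n: "odd n" "n > 1"
  obtains B b where "dwork_diff n r tr = uni z ^ 3 * B" "red z B b"
proof -
  define d where "d = n ^ j"
  define K where "K = trunc tr (n ^ r)"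
  define K' where "K' = trunc tr (n ^ (r - 1))"
  define T where "T = trunc tr (n ^ (r - j))"
  have oddn: "odd (n ^ i)" for i using n by simp
  have K: "K = n * K' + trunc tr n"
    using trunc_mult[OF n(1) oddn[of "r - 1"], of tr] j by (simp add: K_def K'_def power_eq_if[of n r])
  \<comment> \<open>K contains T periods of length d, and K' contains T periods of length m = d / n.
    The common T makes the two counts of zeros comparable.\<close>
  have K1: "K = d * T + trunc tr d"
    using trunc_mult[OF oddn[of j] oddn[of "r - j"], of tr] j by (simp add: K_def T_def d_def flip: power_add)
  define m where "m = n ^ (j - 1)"
  have d: "d = n * m" using j by (simp add: d_def m_def power_eq_if[of n j])
  have K1': "K' = m * T + trunc tr m"
    using trunc_mult[OF oddn[of "j - 1"] oddn[of "r - j"], of tr] j by (simp add: K'_def T_def m_def flip: power_add)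
  have d1: "d > 1" unfolding d_def using n j by (intro one_less_power) auto
  have p': "prim_root z d" using p by (simp add: d_def)
  have "odd d" by (simp add: d_def n)
  have "d dvd n ^ r" using j by (simp add: d_def le_imp_power_dvd)
  define X where "X = (\<lambda>l. qvar ^ (n * (2 * l + 1)) + 1 / qvar ^ (n * (2 * l + 1)))"
  have X2: "2 - X l = - ((1 - qvar ^ (n * (2 * l + 1)))\<^sup>2 / qvar ^ (n * (2 * l + 1)))" for l
    using qvar_nonzero by (simp add: X_def field_simps power2_eq_square)
  define x where "x = (\<lambda>l. z ^ (n * (2 * l + 1)) + 1 / z ^ (n * (2 * l + 1)))"
  have z0: "z \<noteq> 0" using prim_root_nz[OF p] .
  have Xred: "red z (X l) (x l)" for l
    unfolding X_def x_def using z0 by (intro red_add red_divide red_1 red_power red_qvar) simp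
  have inj: "inj_on X {..K'}"
  proof (rule inj_onI)
    fix k l assume "X k = X l"
    define A where "A = qvar ^ (n * (2 * k + 1))"
    define B where "B = qvar ^ (n * (2 * l + 1))"
    have "A * B = qvar ^ (n * (2 * k + 1) + n * (2 * l + 1))" by (simp only: A_def B_def power_add)
    then have AB: "A \<noteq> 0" "B \<noteq> 0" "A * B \<noteq> 1"
      using qvar_nonzero qvar_power_neq_1[of "n * (2 * k + 1) + n * (2 * l + 1)"] n
      by (auto simp: A_def B_def)
    have "A + 1 / A = B + 1 / B" using \<open>X k = X l\<close> unfolding X_def A_def B_def .
    then have "(A - B) * (A * B - 1) = 0" using AB by (simp add: field_simps)
    then have "A = B" using AB by simp
    then have "n * (2 * k + 1) = n * (2 * l + 1)"
      unfolding A_def B_def using powers_distinct[OF qvar_nonzero qvar_power_neq_1] by blast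
    then show "k = l" using n by simp
  qed
  have tn: "(n - 1) div 2 \<le> trunc tr n" by (simp add: trunc_def)
  have root: "poly (diff_poly qvar n K K') (X l) = 0" if "l \<in> {..K'}" for l
    unfolding X_def using that tn K
    by (intro diff_poly_root[OF qvar_nonzero qvar_power_neq_1 n(1)]) auto
  have F0: "red_poly z (diff_poly qvar n K K') 0"
    unfolding K_def K'_def using red_diff_poly[OF p' \<open>d dvd n ^ r\<close> d1 n(1)] j by simp
  obtain G where G: "diff_poly qvar n K K' = (\<Prod>l\<le>K'. [:- X l, 1:]) * G" "red_poly z G 0"
    using red_poly_0_cancel_roots[OF finite_atMost inj F0 root Xred] by blast
  have "red z (poly G 2) 0" using red_poly_eval[OF G(2), of 2 2] red_of_nat[of z 2] by simp
  then obtain g g' where g: "poly G 2 = uni z * g" "red z g g'" by (rule red_0_imp_uni_mult)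
  have ordX: "has_ord z (2 - X l) (if m dvd 2 * l + 1 then 2 else 0)" for l
  proof -
    have pos: "n * (2 * l + 1) > 0" using n by simp
    have "has_ord z (- inverse (qvar ^ (n * (2 * l + 1)))) 0"
      using z0 by (intro has_ord_0[of _ _ "- inverse (z ^ (n * (2 * l + 1)))"] red_uminus red_inverse red_power red_qvar) auto
    from has_ord_mult[OF has_ord_square[OF has_ord_one_minus_power[OF p' pos]] this]
    have "has_ord z (2 - X l) (2 * (if d dvd n * (2 * l + 1) then 1 else 0))"
      unfolding X2 by (simp add: divide_inverse)
    moreover have "d dvd n * (2 * l + 1) \<longleftrightarrow> m dvd 2 * l + 1" unfolding d using n by (intro nat_mult_dvd_cancel1) simp
    ultimately show ?thesis by (cases "m dvd 2 * l + 1") (simp_all only: if_True if_False mult_1_right mult_0_right)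
  qed
  have "odd m" unfolding m_def by (rule oddn)
  then obtain h where h: "m = 2 * h + 1" by (rule oddE)
  have "(\<Sum>l\<le>K'. if m dvd 2 * l + 1 then 2 else 0) = 2 * card {l. l \<le> K' \<and> m dvd 2 * l + 1}"
    by (simp add: sum.If_cases Int_def)
  also have "card {l. l \<le> K' \<and> m dvd 2 * l + 1} = T + 1"
    unfolding K1' using h by (intro card_odd_multiples[OF h]) (auto simp: trunc_def)
  finally have ord1: "has_ord z (\<Prod>l\<le>K'. 2 - X l) (2 * T + 2)"
    using has_ord_prod[of "{..K'}" z "\<lambda>l. 2 - X l" "\<lambda>l. if m dvd 2 * l + 1 then 2 else 0"] ordX by simp
  have ordD: "has_ord z (quad qvar (2 * i + 2) 2) (if d dvd i + 1 then 2 else 0)" for i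
  proof -
    have "has_ord z (quad qvar (2 * i + 2) 2) (2 * (if d dvd 2 * (i + 1) then 1 else 0))"
      unfolding quad_2 using has_ord_square[OF has_ord_one_minus_power[OF p', of "2 * (i + 1)"]] by simp
    moreover have "d dvd 2 * (i + 1) \<longleftrightarrow> d dvd i + 1" by (rule odd_dvd_double[OF \<open>odd d\<close>])
    ultimately show ?thesis by (cases "d dvd i + 1") (simp_all only: if_True if_False mult_1_right mult_0_right)
  qed
  have "(\<Sum>i<K. if d dvd i + 1 then 2 else 0) = 2 * card {i. i < K \<and> d dvd i + 1}"
    by (simp add: sum.If_cases Int_def)
  also have "card {i. i < K \<and> d dvd i + 1} = T"
    unfolding K1 using d1 by (intro card_multiples) (auto simp: trunc_def)
  finally have ord2: "has_ord z (poly (denom qvar K) 2) (2 * T)"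
    unfolding poly_denom
    using has_ord_prod[of "{..<K}" z "\<lambda>i. quad qvar (2 * i + 2) 2" "\<lambda>i. if d dvd i + 1 then 2 else 0"] ordD by simp
  obtain U u where U: "(\<Prod>l\<le>K'. 2 - X l) = uni z ^ (2 * T + 2) * U" "red z U u" using ord1 by (auto simp: has_ord_def)
  obtain V v where V: "poly (denom qvar K) 2 = uni z ^ (2 * T) * V" "red z V v" "v \<noteq> 0" using ord2 by (auto simp: has_ord_def)
  have "poly (denom qvar K) 2 * dwork_diff n r tr = poly (diff_poly qvar n K K') 2"
    using poly_diff_poly_2[of n tr r] K n by (simp add: K_def K'_def)
  also have "\<dots> = (\<Prod>l\<le>K'. 2 - X l) * poly G 2" unfolding G(1) by (simp add: poly_prod)
  finally have "uni z ^ (2 * T) * (V * dwork_diff n r tr) = uni z ^ (2 * T) * (uni z ^ 3 * (U * g))"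
    unfolding U(1) V(1) g(1) by (simp add: power_add power2_eq_square power3_eq_cube algebra_simps)
  then have "V * dwork_diff n r tr = uni z ^ 3 * (U * g)" using uni_nonzero[of z] by simp
  moreover have "V \<noteq> 0" using red_nonzero V by blast
  ultimately have "dwork_diff n r tr = uni z ^ 3 * (U * g / V)" by (simp add: field_simps)
  moreover have "red z (U * g / V) (u * g' / v)" using U g V by (intro red_divide red_mult)
  ultimately show ?thesis by (rule that)
qed

section \<open>The congruences\<close>

text \<open>Polynomials over the complex numbers split into linear factors, so multiplicities decide
  divisibility.\<close>

lemma complex_poly_dvd_if_order_le:
  fixes p u :: "complex poly"
  assumes "p \<noteq> 0" "u \<noteq> 0" "\<And>z. poly p z = 0 \<Longrightarrow> order z p \<le> order z u"
  shows "p dvd u"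
proof -
  let ?P = "\<lambda>p z. [:- z, 1:] ^ order z p"
  have sub: "{z. poly p z = 0} \<subseteq> {z. poly u z = 0}"
  proof (intro subsetI CollectI)
    fix z assume "z \<in> {z. poly p z = 0}"
    then have "poly p z = 0" by simp
    then show "poly u z = 0" using assms(3)[of z] assms(1,2) by (metis order_root le_zero_eq)
  qed
  have "(\<Prod>z | poly p z = 0. ?P p z) dvd (\<Prod>z | poly p z = 0. ?P u z)"
    by (intro prod_dvd_prod le_imp_power_dvd assms) auto
  also have "\<dots> dvd (\<Prod>z | poly u z = 0. ?P u z)"
    using sub assms(2) by (intro prod_dvd_prod_subset poly_roots_finite)
  also have "\<dots> dvd smult (lead_coeff u) (\<Prod>z | poly u z = 0. ?P u z)" by (rule dvd_smult) simp
  also have "\<dots> = u" by (rule complex_poly_decompose)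
  finally have "smult (lead_coeff p) (\<Prod>z | poly p z = 0. ?P p z) dvd u"
    using assms(1) by (subst smult_dvd_iff) simp
  then show ?thesis unfolding complex_poly_decompose .
qed

lemma complex_poly_coprimeI:
  fixes p v :: "complex poly"
  assumes "p \<noteq> 0" "\<And>z. poly p z = 0 \<Longrightarrow> poly v z \<noteq> 0"
  shows "coprime v p"
proof (rule coprimeI)
  fix c assume c: "c dvd v" "c dvd p"
  have "c \<noteq> 0" using c assms(1) by auto
  show "is_unit c"
  proof (rule ccontr)
    assume "\<not> is_unit c"
    then have "\<not> constant (poly c)" using \<open>c \<noteq> 0\<close> by (simp add: constant_degree is_unit_iff_degree)
    then obtain z where "poly c z = 0" using fundamental_theorem_of_algebra by blast
    then show False using c assms(2)[of z] by (auto elim!: dvdE)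
  qed
qed

text \<open>\<open>qcong\<close> asks for one fraction that works at all roots of the modulus at
  once; cancelling common roots until none is left provides it.\<close>

lemma fract_no_common_root:
  fixes A :: rfun
  obtains u v where "v \<noteq> 0" "A = Fract u v" "\<And>z. poly u z = 0 \<Longrightarrow> poly v z \<noteq> 0"
proof -
  have "\<exists>u' v'. v' \<noteq> 0 \<and> Fract u v = Fract u' v' \<and> (\<forall>z. poly u' z = 0 \<longrightarrow> poly v' z \<noteq> 0)"
    if "v \<noteq> 0" for u v :: "complex poly"
    using that
  proof (induction "degree v" arbitrary: u v rule: less_induct)
    case less
    show ?case
    proof (cases "\<exists>z. poly u z = 0 \<and> poly v z = 0")
      case True
      then obtain z where z: "poly u z = 0" "poly v z = 0" by blast
      obtain u' where u': "u = [:- z, 1:] * u'" using z(1) unfolding poly_eq_0_iff_dvd by (rule dvdE)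
      obtain v' where v': "v = [:- z, 1:] * v'" using z(2) unfolding poly_eq_0_iff_dvd by (rule dvdE)
      have nz: "v' \<noteq> 0" using v' less.prems by auto
      have "degree v' < degree v" unfolding v' using nz by (subst degree_mult_eq) auto
      moreover have "Fract u v = Fract u' v'" unfolding u' v' by (rule mult_fract_cancel) simp
      ultimately show ?thesis using less.hyps nz by metis
    qed (use less.prems in blast)
  qed
  moreover obtain u v where "A = Fract u v" "v \<noteq> 0" by (cases A) auto
  ultimately show ?thesis using that by metis
qed

text \<open>With a fraction in lowest terms, the local factorisation at a root z of M bounds the
  order of u from below. Hence u vanishes there, and v does not. If u = 0, lowest terms leave v
  without any root.\<close>

lemma qcong_local:
  assumes M: "M \<noteq> 0"
    and loc: "\<And>z. poly M z = 0 \<Longrightarrow> \<exists>B b. X - Y = uni z ^ order z M * B \<and> red z B b"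
  shows "qcong X Y M"
proof -
  obtain u v where v: "v \<noteq> 0" and D: "X - Y = Fract u v" and cop: "\<And>z. poly u z = 0 \<Longrightarrow> poly v z \<noteq> 0"
    using fract_no_common_root by metis
  have key: "order z M \<le> order z u \<and> poly v z \<noteq> 0" if z: "poly M z = 0" and u: "u \<noteq> 0" for z
  proof -
    obtain B c where B: "X - Y = uni z ^ order z M * B" "red z B c" using loc[OF z] by blast
    obtain a b where ab: "poly b z \<noteq> 0" "b \<noteq> 0" "B = Fract a b" using B(2) by (rule redE)
    have "uni z ^ k = Fract ([:- z, 1:] ^ k) 1" for k by (induction k) (simp_all add: uni_def One_fract_def)
    then have "Fract u v = Fract ([:- z, 1:] ^ order z M * a) b" using D B(1) ab(3) by simp
    then have eq: "u * b = [:- z, 1:] ^ order z M * (a * v)" using v ab(2) by (simp add: eq_fract mult.assoc)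
    then have "[:- z, 1:] ^ order z M dvd u * b" by simp
    then have "order z M \<le> order z (u * b)" using u ab(2) by (subst (asm) order_divides) simp
    also have "\<dots> = order z u" using u ab by (subst order_mult) (simp_all add: order_0I)
    finally have le: "order z M \<le> order z u" .
    have "order z M \<noteq> 0" using z M by (simp add: order_root)
    then have "poly u z = 0" using le by (metis le_zero_eq order_0I)
    then have "poly v z \<noteq> 0" by (rule cop)
    then show ?thesis using le by blast
  qed
  have "M dvd u \<and> coprime v M"
  proof (cases "u = 0")
    case True
    then show ?thesis using cop complex_poly_coprimeI[OF M] by simp
  next
    case False
    then show ?thesis using key complex_poly_dvd_if_order_le[OF M False] complex_poly_coprimeI[OF M] by blast
  qed
  then show ?thesis unfolding qcong_def using v D by blast
qed

section \<open>The order of the modulus at a point\<close>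

lemma order_prod_sum:
  "finite I \<Longrightarrow> (\<And>i. i \<in> I \<Longrightarrow> f i \<noteq> 0) \<Longrightarrow> order z (prod f I) = (\<Sum>i\<in>I. order z (f i :: complex poly))"
  by (induction I rule: finite_induct) (simp_all add: order_mult)

lemma poly_qint_poly: "poly (qint_poly N) z = qnum z N"
  by (simp add: qint_poly_def qnum_def poly_sum poly_monom)

lemma qint_poly_eq: "[:- 1, 1:] * qint_poly N = monom 1 N - 1"
proof -
  have 1: "(1 - monom 1 1) * qint_poly N = 1 - monom 1 N"
    using one_diff_power_eq[of "monom 1 1 :: complex poly" N] by (simp add: qint_poly_def monom_power)
  have 2: "[:- 1, 1:] = - (1 - monom 1 1 :: complex poly)" by (simp add: monom_altdef one_pCons)
  have "[:- 1, 1:] * qint_poly N = - ((1 - monom 1 1) * qint_poly N)" unfolding 2 by (rule mult_minus_left)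
  then show ?thesis unfolding 1 minus_diff_eq .
qed

lemma qint_poly_root:
  assumes "N > 0" "poly (qint_poly N) z = 0"
  shows "z ^ N = 1" "z \<noteq> 1"
proof -
  show "z ^ N = 1" using qnum_times[of z N] assms by (simp add: poly_qint_poly)
  show "z \<noteq> 1" using assms by (auto simp: poly_qint_poly qnum_of_1)
qed

text \<open>A double root of [N] would be a double root of q^N - 1, whose derivative vanishes only
  at 0.\<close>

lemma order_qint_poly:
  assumes "N > 0"
  shows "order z (qint_poly N) \<le> 1" "qint_poly N \<noteq> 0"
proof -
  show nz: "qint_poly N \<noteq> 0" using poly_qint_poly[of N 1] assms by (auto simp: qnum_of_1)
  show "order z (qint_poly N) \<le> 1"
  proof (rule ccontr)
    assume o: "\<not> order z (qint_poly N) \<le> 1"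
    then have "poly (qint_poly N) z = 0" by (metis order_0I zero_le)
    then have z: "z ^ N = 1" using qint_poly_root[OF assms] by blast
    have "[:- z, 1:] ^ 2 dvd qint_poly N" using o by (simp add: order_divides)
    then obtain w where "qint_poly N = [:- z, 1:] ^ 2 * w" by (rule dvdE)
    then have "monom 1 N - 1 = [:- z, 1:] * ([:- z, 1:] * ([:- 1, 1:] * w))"
      unfolding qint_poly_eq[symmetric] by (simp only: power2_eq_square mult.assoc mult.left_commute)
    then have "pderiv (monom 1 N - 1) = pderiv ([:- z, 1:] * ([:- z, 1:] * ([:- 1, 1:] * w)))" by (rule arg_cong)
    then have "poly (pderiv (monom 1 N - 1)) z = 0"
      by (simp only: pderiv_mult poly_add poly_mult) simp
    then have "of_nat N * z ^ (N - 1) = 0" by (simp add: pderiv_diff pderiv_monom poly_monom)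
    then show False using assms z by (auto simp: zero_power)
  qed
qed

lemma prim_root_cis:
  assumes "coprime k m" "m > 0"
  shows "prim_root (cis (2 * pi * real k / real m)) m"
proof -
  have "cis (2 * pi * real k / real m) ^ i = 1 \<longleftrightarrow> m dvd i" for i
  proof
    assume "cis (2 * pi * real k / real m) ^ i = 1"
    then have "cis (real i * (2 * pi * real k / real m)) = 1" by (simp only: DeMoivre)
    then have "cos (real i * (2 * pi * real k / real m)) = 1" by (metis cis.simps(1) one_complex.simps(1))
    then obtain a :: int where "real i * (2 * pi * real k / real m) = a * 2 * pi" by (auto simp: cos_one_2pi_int)
    then have "2 * pi * (real i * real k) = 2 * pi * (a * real m)" using assms by (simp add: field_simps)
    then have "real_of_int (int i * int k) = real_of_int (a * int m)" by (simp only: mult_cancel_left) simp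
    then have "int i * int k = a * int m" by (simp only: of_int_eq_iff)
    then have "int m dvd int (i * k)" by simp
    then show "m dvd i" using assms by (simp add: coprime_dvd_mult_left_iff coprime_commute del: of_nat_mult)
  next
    assume "m dvd i"
    then obtain t where "i = m * t" by (rule dvdE)
    then have "real i * (2 * pi * real k / real m) = 2 * pi * real (t * k)" using assms by simp
    then show "cis (2 * pi * real k / real m) ^ i = 1" by (simp only: DeMoivre cis_multiple_2pi[OF Ints_of_nat])
  qed
  then show ?thesis using assms by (simp add: prim_root_def)
qed

text \<open>An upper bound suffices, as the order of the modulus is compared with a lower bound for
  the difference.\<close>

lemma order_cyclotomic:
  assumes "m > 1"
  shows "order z (cyclotomic m) \<le> (if prim_root z m then 1 else 0)" "cyclotomic m \<noteq> 0"
proof -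
  let ?S = "{k \<in> {1..m}. coprime k m}"
  let ?c = "\<lambda>k. cis (2 * pi * real k / real m)"
  \<comment> \<open>For m > 1 the index k = m is not coprime to m, so the indices lie in the range k
    < m on which the roots of unity are known to be distinct.\<close>
  have S: "?S \<subseteq> {..<m}" using assms by (auto simp: order.order_iff_strict)
  have "inj_on ?c {..<m}" using bij_betw_roots_unity[of m] assms by (auto simp: bij_betw_def)
  then have inj: "inj_on ?c ?S" using S by (rule inj_on_subset)
  show "cyclotomic m \<noteq> 0" by (simp add: cyclotomic_def)
  have "order z (cyclotomic m) = (\<Sum>k\<in>?S. order z [:- ?c k, 1:])"
    unfolding cyclotomic_def by (rule order_prod_sum) simp_all
  also have "\<dots> = (\<Sum>k\<in>?S. if ?c k = z then 1 else 0)"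
  proof (rule sum.cong[OF refl])
    fix k
    show "order z [:- ?c k, 1:] = (if ?c k = z then 1 else 0)"
      using order_power_n_n[of z 1] by (auto intro: order_0I)
  qed
  also have "\<dots> = card {k \<in> ?S. ?c k = z}" by (simp add: sum.If_cases Int_def)
  also have "\<dots> \<le> (if prim_root z m then 1 else 0)"
  proof (cases "prim_root z m")
    case True
    have "card {k \<in> ?S. ?c k = z} \<le> Suc 0"
      using inj by (subst card_le_Suc0_iff_eq) (auto simp: inj_on_def)
    then show ?thesis using True by simp
  next
    case False
    then have "{k \<in> ?S. ?c k = z} = {}" using prim_root_cis[of _ m] assms by auto
    then show ?thesis unfolding if_not_P[OF False] by (simp only: card.empty)
  qed
  finally show "order z (cyclotomic m) \<le> (if prim_root z m then 1 else 0)" .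
qed

lemma prim_root_unique: "prim_root z d \<Longrightarrow> prim_root z e \<Longrightarrow> d = e"
  using prim_rootD[of z d d] prim_rootD[of z e d] prim_rootD[of z e e] prim_rootD[of z d e] by (auto intro: dvd_antisym)

definition dwork_modulus :: "nat \<Rightarrow> nat \<Rightarrow> complex poly" where
  "dwork_modulus n r = qint_poly (n ^ r) * (\<Prod>j=1..r. cyclotomic (n ^ j) ^ 2)"

text \<open>A point is a primitive root of unity of at most one order, so at most one of the squared
  cyclotomic factors vanishes: 1 + 2 = 3.\<close>

lemma order_dwork_modulus:
  assumes n: "n > 1"
  shows "dwork_modulus n r \<noteq> 0"
    and "order z (dwork_modulus n r) \<le> (if \<exists>j\<in>{1..r}. prim_root z (n ^ j) then 3 else 1)"
proof -
  have nj: "n ^ j > 1" if "j \<in> {1..r}" for j using that n by (intro one_less_power) auto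
  have N: "n ^ r > 0" using n by simp
  have c: "cyclotomic (n ^ j) ^ 2 \<noteq> 0" if "j \<in> {1..r}" for j using order_cyclotomic(2)[OF nj[OF that]] by simp
  have p: "(\<Prod>j=1..r. cyclotomic (n ^ j) ^ 2) \<noteq> 0" using c by (subst prod_zero_iff) auto
  show nz: "dwork_modulus n r \<noteq> 0" unfolding dwork_modulus_def using p order_qint_poly(2)[OF N] by simp
  let ?A = "{j \<in> {1..r}. prim_root z (n ^ j)}"
  have "order z (\<Prod>j=1..r. cyclotomic (n ^ j) ^ 2) = (\<Sum>j=1..r. order z (cyclotomic (n ^ j) ^ 2))"
    using c by (intro order_prod_sum) auto
  also have "\<dots> \<le> (\<Sum>j=1..r. if prim_root z (n ^ j) then 2 else 0)"
  proof (rule sum_mono)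
    fix j assume j: "j \<in> {1..r}"
    have "order z (cyclotomic (n ^ j) ^ 2) = 2 * order z (cyclotomic (n ^ j))"
      using c[OF j] unfolding power2_eq_square by (subst order_mult) auto
    then show "order z (cyclotomic (n ^ j) ^ 2) \<le> (if prim_root z (n ^ j) then 2 else 0)"
      using order_cyclotomic(1)[OF nj[OF j], of z] by (auto split: if_splits)
  qed
  also have "\<dots> = 2 * card ?A" by (simp add: sum.If_cases Int_def)
  finally have 1: "order z (dwork_modulus n r) \<le> 1 + 2 * card ?A"
    using order_qint_poly(1)[OF N, of z] nz unfolding dwork_modulus_def by (subst order_mult) auto
  have "card ?A \<le> Suc 0"
  proof (subst card_le_Suc0_iff_eq, simp, intro ballI)
    fix i j assume "i \<in> ?A" "j \<in> ?A"
    then have "n ^ i = n ^ j" using prim_root_unique by blast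
    then show "i = j" using n by simp
  qed
  then show "order z (dwork_modulus n r) \<le> (if \<exists>j\<in>{1..r}. prim_root z (n ^ j) then 3 else 1)"
  proof (cases "\<exists>j\<in>{1..r}. prim_root z (n ^ j)")
    case True
    then show ?thesis unfolding if_P[OF True] using 1 \<open>card ?A \<le> Suc 0\<close> by linarith
  next
    case False
    then have "card ?A = 0" by auto
    then show ?thesis unfolding if_not_P[OF False] using 1 by linarith
  qed
qed

lemma dwork_modulus_root:
  assumes n: "n > 1" "r > 0" and z: "poly (dwork_modulus n r) z = 0"
  obtains d where "prim_root z d" "d dvd n ^ r" "d > 1"
proof -
  have N: "n ^ r > 0" using n by simp
  consider "poly (qint_poly (n ^ r)) z = 0" | j where "j \<in> {1..r}" "poly (cyclotomic (n ^ j)) z = 0"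
    using z by (auto simp: dwork_modulus_def poly_prod)
  then show ?thesis
  proof cases
    case 1
    then obtain d where d: "prim_root z d" "d dvd n ^ r" using qint_poly_root[OF N] prim_root_exists[OF _ N] by metis
    have "d > 0" "\<not> d dvd 1" using d(1) prim_rootD[OF d(1), of 1] qint_poly_root(2)[OF N 1] by (auto simp: prim_root_def)
    then have "d > 1" by (cases "d = 1") auto
    with d show ?thesis using that by blast
  next
    case 2
    have nj: "n ^ j > 1" using 2(1) n by (intro one_less_power) auto
    have "order z (cyclotomic (n ^ j)) \<noteq> 0" using 2 order_cyclotomic(2)[OF nj] by (simp add: order_root)
    then have "prim_root z (n ^ j)" using order_cyclotomic(1)[OF nj, of z] by (auto split: if_splits)
    moreover have "n ^ j dvd n ^ r" using 2(1) by (simp add: le_imp_power_dvd)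
    ultimately show ?thesis using that nj by blast
  qed
qed

lemma qcong_dwork:
  assumes n: "n > 1" "odd n" "r \<ge> 1" and D: "X - Y = dwork_diff n r b"
  shows "qcong X Y (dwork_modulus n r)"
proof (rule qcong_local[OF order_dwork_modulus(1)[OF n(1)]])
  fix z assume z: "poly (dwork_modulus n r) z = 0"
  let ?o = "order z (dwork_modulus n r)"
  obtain k B c where k: "?o \<le> k" "X - Y = uni z ^ k * B" "red z B c"
  proof (cases "\<exists>j\<in>{1..r}. prim_root z (n ^ j)")
    case True
    then obtain j where j: "prim_root z (n ^ j)" "1 \<le> j" "j \<le> r" by auto
    obtain B c where "dwork_diff n r b = uni z ^ 3 * B" "red z B c"
      using triple_vanishing[OF j n(2,1)] by blast
    moreover have "?o \<le> 3" using order_dwork_modulus(2)[OF n(1), of z r] True by simp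
    ultimately show ?thesis using that D by metis
  next
    case False
    obtain d where d: "prim_root z d" "d dvd n ^ r" "d > 1" using dwork_modulus_root[OF n(1) _ z] n(3) by auto
    have "red z (dwork_diff n r b) 0" using red_dwork_diff[OF d n(2)] n(3) by simp
    then obtain B c where "dwork_diff n r b = uni z * B" "red z B c" by (rule red_0_imp_uni_mult)
    moreover have "?o \<le> 1" using order_dwork_modulus(2)[OF n(1), of z r] False by simp
    ultimately show ?thesis using that[of 1 B c] D by simp
  qed
  \<comment> \<open>The known order k may exceed that of the modulus; surplus powers of the
    uniformiser go into the cofactor.\<close>
  have "uni z ^ k = uni z ^ ?o * uni z ^ (k - ?o)" using k(1) by (simp flip: power_add)
  then have "X - Y = uni z ^ ?o * (uni z ^ (k - ?o) * B)" using k(2) by simp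
  moreover have "red z (uni z ^ (k - ?o) * B) (0 ^ (k - ?o) * c)" using k(3) by (intro red_mult red_power red_uni)
  ultimately show "\<exists>B b. X - Y = uni z ^ ?o * B \<and> red z B b" by blast
qed

lemma qint_eq_qnum: "qint = qnum"
  by (intro ext) (simp add: qint_def qnum_def)

lemma qpoch_quotient: "qpoch Q (Q ^ 2) k ^ 4 / qpoch (Q ^ 2) (Q ^ 2) k ^ 4 = beta Q k ^ 4"
proof -
  have "qpoch Q (Q ^ 2) k = (\<Prod>i<k. 1 - Q ^ (2 * i + 1))" "qpoch (Q ^ 2) (Q ^ 2) k = (\<Prod>i<k. 1 - Q ^ (2 * i + 2))"
    by (simp_all add: qpoch_def power_mult power2_eq_square mult.assoc)
  then show ?thesis by (simp add: beta_def prod_dividef power_divide)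
qed

theorem theorem1p1:
  fixes n r :: nat
  assumes "n > 1" and "odd n" and "r \<ge> 1"
  shows "qcong
           (\<Sum>k=0..(n ^ r - 1) div 2. qint qvar (4 * k + 1) *
              qpoch qvar (qvar ^ 2) k ^ 4 / qpoch (qvar ^ 2) (qvar ^ 2) k ^ 4)
           (inverse (qvar ^ ((n - 1) div 2)) * qint qvar n *
              (\<Sum>k=0..(n ^ (r - 1) - 1) div 2. qint (qvar ^ n) (4 * k + 1) *
                 qpoch (qvar ^ n) (qvar ^ (2 * n)) k ^ 4 /
                 qpoch (qvar ^ (2 * n)) (qvar ^ (2 * n)) k ^ 4))
           (qint_poly (n ^ r) * (\<Prod>j=1..r. cyclotomic (n ^ j) ^ 2))
       \<and> qcong
           (\<Sum>k=0..n ^ r - 1. qint qvar (4 * k + 1) *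
              qpoch qvar (qvar ^ 2) k ^ 4 / qpoch (qvar ^ 2) (qvar ^ 2) k ^ 4)
           (inverse (qvar ^ ((n - 1) div 2)) * qint qvar n *
              (\<Sum>k=0..n ^ (r - 1) - 1. qint (qvar ^ n) (4 * k + 1) *
                 qpoch (qvar ^ n) (qvar ^ (2 * n)) k ^ 4 /
                 qpoch (qvar ^ (2 * n)) (qvar ^ (2 * n)) k ^ 4))
           (qint_poly (n ^ r) * (\<Prod>j=1..r. cyclotomic (n ^ j) ^ 2))"
proof -
  have Q: "qvar ^ (2 * n) = (qvar ^ n) ^ 2" by (simp add: power_mult[symmetric] mult.commute)
  have D: "(\<Sum>k=0..trunc b (n ^ r). qint qvar (4 * k + 1) * qpoch qvar (qvar ^ 2) k ^ 4 / qpoch (qvar ^ 2) (qvar ^ 2) k ^ 4)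
     - inverse (qvar ^ ((n - 1) div 2)) * qint qvar n *
        (\<Sum>k=0..trunc b (n ^ (r - 1)). qint (qvar ^ n) (4 * k + 1) * qpoch (qvar ^ n) (qvar ^ (2 * n)) k ^ 4 /
           qpoch (qvar ^ (2 * n)) (qvar ^ (2 * n)) k ^ 4) = dwork_diff n r b" for b
    unfolding Q times_divide_eq_right[symmetric] qpoch_quotient qint_eq_qnum dwork_diff_def prefactor_def atLeast0AtMost
    by (simp add: divide_inverse mult.commute)
  \<comment> \<open>\<open>False\<close> selects the half sums and \<open>True\<close> the full
    sums.\<close>
  show ?thesis
    using qcong_dwork[OF assms D[of False]] qcong_dwork[OF assms D[of True]]
    unfolding dwork_modulus_def trunc_def if_True if_False by blast
qed

end
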